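(* Let $\mathcal M=(A,B,Q,R,\Sigma_W,\gamma)$ and $\hat{\mathcal M}=(\hat A,\hat B,\hat Q,\hat R,\hat\Sigma_W,\gamma)$ be two linear quadratic regulator models on $\mathcal S=\mathbb R^{n_s}$, $\mathcal A=\mathbb R^{n_a}$ satisfying the standard stabilizability and detectability conditions, let $\ell>0$ and $w(s)=1+\ell s^\intercal s$. Assume both models are DP-solvable with respect to $w$, and that $$b_\Sigma:=\max\{1+\ell\operatorname{Tr}(\Sigma_W),\,1+\ell\operatorname{Tr}(\hat\Sigma_W)\}<\frac1\gamma,$$ $$b_\sigma:=\max\{\sigma_1^2(A_{K^\star}),\,\sigma_1^2(A_{\hat K^\star}),\,\sigma_1^2(\hat A_{\hat K^\star}),\,\sigma_1^2(A_{K_{\mu^\star}})\}<\frac1\gamma .$$ Let $\kappa=\max\{b_\Sigma,b_\sigma\}$. Then for every $\alpha_2\in\mathbb R$, $$\|V^{\hat\pi^\star}-V^\star\|_w\le\frac{1}{1-\gamma\kappa}\Bigl[\max\{\rho(D^\star)/\ell,\,|d_\Sigma+\alpha_2|\}+\max\{\rho(D^{\hat\pi^\star})/\ell,\,|d_\Sigma+\alpha_2|\}\Bigr],$$ where $\rho(\cdot)$ denotes the spectral radius and $$D^\star=Q+\gamma A^\intercal\hat PA-\gamma^2A^\intercal\hat PB(R+\gamma B^\intercal\hat PB)^{-1}B^\intercal\hat PA-\hat P,$$ $$D^{\hat\pi^\star}=Q+(\hat K^\star)^\intercal R\hat K^\star+\gamma A_{\hat K^\star}^\intercal\hat PA_{\hat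 K^\star}-\hat P,$$ $$\hat K^\star=\gamma(\hat R+\gamma\hat B^\intercal\hat P\hat B)^{-1}\hat B^\intercal\hat P\hat A,\qquad d_\Sigma=\gamma\operatorname{Tr}((\Sigma_W-\hat\Sigma_W)\hat P).$$ In particular (taking $\alpha_2=-d_\Sigma$), $$\|V^{\hat\pi^\star}-V^\star\|_w\le\frac{1}{\ell(1-\gamma\kappa)}\bigl[\rho(D^\star)+\rho(D^{\hat\pi^\star})\bigr].$$
   Context: LQR model. $\mathcal M=(A,B,Q,R,\Sigma_W,\gamma)$ is the infinite-horizon discounted Markov decision process with state space $\mathbb R^{n_s}$, action space $\mathbb R^{n_a}$, dynamics $s_{t+1}=As_t+Ba_t+\xi_t$ with $\{\xi_t\}$ i.i.d. zero-mean with (finite) covariance $\Sigma_W$, per-step cost $c(s,a)=s^\intercal Qs+a^\intercal Ra$ with $Q$ positive semidefinite and $R$ positive definite, and discount factor $\gamma\in(0,1)$. $\hat{\mathcal M}$ is defined likewise with hatted matrices. Policies are stochastic kernels $\pi:\mathcal S\to\Delta(\mathcal A)$ ($\Pi$ is the set of all of them); $V^\pi(s)=\mathbb E^\pi[\sum_{t\ge1}\gamma^{t-1}c(S_t,A_t)|S_1=s]$ is the value function of $\pi$ in $\mathcal M$ and $V^\star$ the optimal value function of $\mathcal M$. $\|v\|_w=\sup_s|v(s)|/w(s)$. Let $\mathcal V_w$ be the set of nonnegative measurable functions with finite $\|\cdot\|_w$. With $[\mathcal B^\pi v](s)=\int\pi(da|s)\{c(s,a)+\gamma\mathbb E[v(As+Ba+\xi)]\}$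 and $[\mathcal B^\star v](s)=\inf_a\{c(s,a)+\gamma\mathbb E[v(As+Ba+\xi)]\}$, the model is DP-solvable with respect to $w$ if (i) $\mathcal B^\star v\in\mathcal V_w$ for all $v\in\mathcal V_w$; (ii) there is $V^\star\in\mathcal V_w$ with $V^\star\le V^\pi$ for all $\pi\in\Pi$, with equality at all states for at least one $\pi$; (iii) $V^\star=\mathcal B^\star V^\star$. Standing stabilizability/detectability: $(\sqrt\gamma A,\sqrt\gamma B)$ stabilizable and $(\sqrt\gamma A,Q^{1/2})$ detectable, and likewise for the hatted matrices. Then $V^\star(s)=s^\intercal Ps+q$, where $P$ is the unique positive semidefinite solution of $P=Q+\gamma A^\intercal PA-\gamma^2A^\intercal PB(R+\gamma B^\intercal PB)^{-1}B^\intercal PA$ and $q=\gamma\operatorname{Tr}(\Sigma_WP)/(1-\gamma)$; the optimal policy is $\pi^\star(s)=-K^\star s$ with $K^\star=\gamma(R+\gamma B^\intercal PB)^{-1}B^\intercal PA$. For $\hat{\mathcal M}$, the same holds with $\hat P,\hat q,\hat V^\star,\hat K^\star$; $\hat\pi^\star(s)=-\hat K^\star s$ is the optimal policy of $\hat{\mathcal M}$. Notation: $A_K=A-BK$, $\hat A_K=\hat A-\hat BK$; $\sigma_1(\cdot)$ is the largest singular value. $K_{\mu^\star}$ is the gain of the unique policy $\mu^\star(s)=-K_{\mu^\star}s$ with $\mathcal B^{\mu^\star}\hat V^\star=\mathcal B^\star\hat V^\star$ (operators of the model $\mathcal M$). *)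

theory Defs
  imports "HOL-Probability.Probability"
begin

section \<open>Matrices\<close>

definition psd_mat :: "real^'n^'n \<Rightarrow> bool" where
  "psd_mat X \<longleftrightarrow> transpose X = X \<and> (\<forall>x. 0 \<le> x \<bullet> (X *v x))"

definition pd_mat :: "real^'n^'n \<Rightarrow> bool" where
  "pd_mat X \<longleftrightarrow> transpose X = X \<and> (\<forall>x. x \<noteq> 0 \<longrightarrow> 0 < x \<bullet> (X *v x))"

definition mat_spectrum :: "real^'n^'n \<Rightarrow> complex set" where
  "mat_spectrum X = {z. \<exists>v :: complex^'n. v \<noteq> 0 \<and> map_matrix complex_of_real X *v v = z *s v}"

definition mat_spectral_radius :: "real^'n^'n \<Rightarrow> real" where
  "mat_spectral_radius X = (SUP z\<in>mat_spectrum X. cmod z)"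

definition singular_values :: "real^'n^'m \<Rightarrow> real set" where
  "singular_values X =
     {\<sigma>. 0 \<le> \<sigma> \<and> (\<exists>v. v \<noteq> 0 \<and> (transpose X ** X) *v v = \<sigma>\<^sup>2 *\<^sub>R v)}"

definition max_singular_value :: "real^'n^'m \<Rightarrow> real" where
  "max_singular_value X = Sup (singular_values X)"

text \<open>Discrete time: stability means that all eigenvalues lie in the open unit disc.\<close>

definition stabilizable :: "real^'s^'s \<Rightarrow> real^'a^'s \<Rightarrow> bool" where
  "stabilizable A B \<longleftrightarrow> (\<exists>K. mat_spectral_radius (A - B ** K) < 1)"

definition detectable :: "real^'s^'s \<Rightarrow> real^'s^'o \<Rightarrow> bool" where
  "detectable A C \<longleftrightarrow> (\<exists>L. mat_spectral_radius (A - L ** C) < 1)"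


section \<open>LQR models\<close>

text \<open>
  The law of the noise is part of the model; of this law only the mean and the covariance
  \<open>lqr_Sigma\<close> are prescribed (see \<open>lqr_model\<close> below).
\<close>

record ('s::finite, 'a::finite) lqr =
  lqr_A :: "real^'s^'s"
  lqr_B :: "real^'a^'s"
  lqr_Q :: "real^'s^'s"
  lqr_R :: "real^'a^'a"
  lqr_Sigma :: "real^'s^'s"
  lqr_gamma :: real
  lqr_noise :: "(real^'s) measure"

definition lqr_model :: "('s::finite, 'a::finite) lqr \<Rightarrow> bool" where
  "lqr_model M \<longleftrightarrow>
     psd_mat (lqr_Q M) \<and> pd_mat (lqr_R M) \<and> 0 < lqr_gamma M \<and> lqr_gamma M < 1 \<and>
     prob_space (lqr_noise M) \<and> sets (lqr_noise M) = sets borel \<and>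
     has_bochner_integral (lqr_noise M) (\<lambda>\<xi>. \<xi>) 0 \<and>
     (\<forall>i j. has_bochner_integral (lqr_noise M) (\<lambda>\<xi>. \<xi> $ i * \<xi> $ j) (lqr_Sigma M $ i $ j))"

text \<open>The existential quantifier ranges over the unique square root \<open>Q\<^sup>1\<^sup>/\<^sup>2\<close> of \<open>Q\<close>.\<close>

definition lqr_stab_det :: "('s::finite, 'a::finite) lqr \<Rightarrow> bool" where
  "lqr_stab_det M \<longleftrightarrow>
     stabilizable (sqrt (lqr_gamma M) *\<^sub>R lqr_A M) (sqrt (lqr_gamma M) *\<^sub>R lqr_B M) \<and>
     (\<exists>H. psd_mat H \<and> H ** H = lqr_Q M \<and> detectable (sqrt (lqr_gamma M) *\<^sub>R lqr_A M) H)"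

definition lqr_next ::
    "('s::finite, 'a::finite) lqr \<Rightarrow> real^'s \<Rightarrow> real^'a \<Rightarrow> real^'s \<Rightarrow> real^'s" where
  "lqr_next M s a \<xi> = lqr_A M *v s + lqr_B M *v a + \<xi>"

definition lqr_cost :: "('s::finite, 'a::finite) lqr \<Rightarrow> real^'s \<Rightarrow> real^'a \<Rightarrow> real" where
  "lqr_cost M s a = s \<bullet> (lqr_Q M *v s) + a \<bullet> (lqr_R M *v a)"


section \<open>Policies and value functions\<close>

type_synonym ('s, 'a) policy = "real^'s \<Rightarrow> (real^'a) measure"

definition policies :: "('s::finite, 'a::finite) policy set" where
  "policies = borel \<rightarrow>\<^sub>M prob_algebra borel"

definition linear_policy :: "real^'s^'a \<Rightarrow> ('s::finite, 'a::finite) policy" where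
  "linear_policy K s = return borel (- (K *v s))"

definition state_action_law ::
    "('s::finite, 'a::finite) policy \<Rightarrow> real^'s \<Rightarrow> ((real^'s) \<times> (real^'a)) measure" where
  "state_action_law \<pi> s = distr (\<pi> s) borel (\<lambda>a. (s, a))"

definition traj_kernel ::
    "('s::finite, 'a::finite) lqr \<Rightarrow> ('s, 'a) policy \<Rightarrow> real^'s \<Rightarrow>
     nat \<Rightarrow> (nat \<Rightarrow> (real^'s) \<times> (real^'a)) \<Rightarrow> ((real^'s) \<times> (real^'a)) measure" where
  "traj_kernel M \<pi> s n \<omega> =
     (case n of
        0 \<Rightarrow> state_action_law \<pi> s
      | Suc m \<Rightarrow> lqr_noise M \<bind>
          (\<lambda>\<xi>. state_action_law \<pi> (lqr_next M (fst (\<omega> m)) (snd (\<omega> m)) \<xi>)))"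

text \<open>
  The law of the whole trajectory of state-action pairs under \<open>\<pi>\<close> started in \<open>s\<close>, as provided by
  the Ionescu-Tulcea theorem. Time starts at 0 here, so the discount factor at time \<open>t\<close> is \<open>\<gamma>\<^sup>t\<close>.
\<close>

definition traj_measure ::
    "('s::finite, 'a::finite) lqr \<Rightarrow> ('s, 'a) policy \<Rightarrow> real^'s \<Rightarrow>
     (nat \<Rightarrow> (real^'s) \<times> (real^'a)) measure" where
  "traj_measure M \<pi> s =
     projective_family.lim UNIV (Ionescu_Tulcea.CI (traj_kernel M \<pi> s) (\<lambda>_. borel)) (\<lambda>_. borel)"

definition policy_value ::
    "('s::finite, 'a::finite) lqr \<Rightarrow> ('s, 'a) policy \<Rightarrow> real^'s \<Rightarrow> ennreal" where
  "policy_value M \<pi> s =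
     (\<integral>\<^sup>+ \<omega>. (\<Sum>t. ennreal (lqr_gamma M ^ t * lqr_cost M (fst (\<omega> t)) (snd (\<omega> t))))
        \<partial>traj_measure M \<pi> s)"

definition optimal_value :: "('s::finite, 'a::finite) lqr \<Rightarrow> real^'s \<Rightarrow> ennreal" where
  "optimal_value M s = (INF \<pi>\<in>policies. policy_value M \<pi> s)"


section \<open>Bellman operators and DP-solvability\<close>

definition q_value ::
    "('s::finite, 'a::finite) lqr \<Rightarrow> (real^'s \<Rightarrow> ennreal) \<Rightarrow> real^'s \<Rightarrow> real^'a \<Rightarrow> ennreal" where
  "q_value M v s a =
     ennreal (lqr_cost M s a) + ennreal (lqr_gamma M) * (\<integral>\<^sup>+ \<xi>. v (lqr_next M s a \<xi>) \<partial>lqr_noise M)"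

definition bellman_policy ::
    "('s::finite, 'a::finite) lqr \<Rightarrow> ('s, 'a) policy \<Rightarrow> (real^'s \<Rightarrow> ennreal) \<Rightarrow> real^'s \<Rightarrow> ennreal"
  where
  "bellman_policy M \<pi> v s = (\<integral>\<^sup>+ a. q_value M v s a \<partial>\<pi> s)"

definition bellman_opt ::
    "('s::finite, 'a::finite) lqr \<Rightarrow> (real^'s \<Rightarrow> ennreal) \<Rightarrow> real^'s \<Rightarrow> ennreal" where
  "bellman_opt M v s = (INF a. q_value M v s a)"

text \<open>
  Extended reals, so that nothing is lost for functions with infinite values: both \<open>\<bar>\<infinity>\<bar>\<close> and
  \<open>\<bar>\<infinity> - \<infinity>\<bar>\<close> are \<open>\<infinity>\<close>.
\<close>

definition wnorm :: "('x \<Rightarrow> real) \<Rightarrow> ('x \<Rightarrow> ereal) \<Rightarrow> ereal" where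
  "wnorm w v = (SUP s. \<bar>v s\<bar> / ereal (w s))"

definition weighted_funs :: "(real^'s \<Rightarrow> real) \<Rightarrow> (real^'s \<Rightarrow> ennreal) set" where
  "weighted_funs w = {v \<in> borel_measurable borel. wnorm w (\<lambda>s. enn2ereal (v s)) < \<infinity>}"

definition dp_solvable :: "('s::finite, 'a::finite) lqr \<Rightarrow> (real^'s \<Rightarrow> real) \<Rightarrow> bool" where
  "dp_solvable M w \<longleftrightarrow>
     (\<forall>v\<in>weighted_funs w. bellman_opt M v \<in> weighted_funs w) \<and>
     (\<exists>V\<in>weighted_funs w.
        (\<forall>\<pi>\<in>policies. \<forall>s. V s \<le> policy_value M \<pi> s) \<and>
        (\<exists>\<pi>\<in>policies. \<forall>s. V s = policy_value M \<pi> s) \<and>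
        V = bellman_opt M V)"

definition quad_weight :: "real \<Rightarrow> real^'s \<Rightarrow> real" where
  "quad_weight l s = 1 + l * (s \<bullet> s)"


section \<open>Riccati equation, gains and the quantities in the bound\<close>

definition riccati_op :: "('s::finite, 'a::finite) lqr \<Rightarrow> real^'s^'s \<Rightarrow> real^'s^'s" where
  "riccati_op M X =
     (let A = lqr_A M; B = lqr_B M; Q = lqr_Q M; R = lqr_R M; \<gamma> = lqr_gamma M in
      Q + \<gamma> *\<^sub>R (transpose A ** X ** A)
        - \<gamma>\<^sup>2 *\<^sub>R (transpose A ** X ** B ** matrix_inv (R + \<gamma> *\<^sub>R (transpose B ** X ** B))
                   ** transpose B ** X ** A))"

definition riccati_sol :: "('s::finite, 'a::finite) lqr \<Rightarrow> real^'s^'s" where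
  "riccati_sol M = (THE P. psd_mat P \<and> P = riccati_op M P)"

definition opt_gain :: "('s::finite, 'a::finite) lqr \<Rightarrow> real^'s^'a" where
  "opt_gain M =
     (let A = lqr_A M; B = lqr_B M; R = lqr_R M; \<gamma> = lqr_gamma M; P = riccati_sol M in
      \<gamma> *\<^sub>R (matrix_inv (R + \<gamma> *\<^sub>R (transpose B ** P ** B)) ** transpose B ** P ** A))"

text \<open>The gain of the linear policy that is greedy in \<open>M\<close> for the optimal value function of \<open>M'\<close>.\<close>

definition greedy_gain ::
    "('s::finite, 'a::finite) lqr \<Rightarrow> ('s, 'a) lqr \<Rightarrow> real^'s^'a" where
  "greedy_gain M M' =
     (THE K. bellman_policy M (linear_policy K) (optimal_value M') = bellman_opt M (optimal_value M'))"

definition closed_loop :: "('s::finite, 'a::finite) lqr \<Rightarrow> real^'s^'a \<Rightarrow> real^'s^'s" where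
  "closed_loop M K = lqr_A M - lqr_B M ** K"

definition b_Sigma ::
    "real \<Rightarrow> ('s::finite, 'a::finite) lqr \<Rightarrow> ('s, 'a) lqr \<Rightarrow> real" where
  "b_Sigma l M M' = max (1 + l * trace (lqr_Sigma M)) (1 + l * trace (lqr_Sigma M'))"

definition b_sigma :: "('s::finite, 'a::finite) lqr \<Rightarrow> ('s, 'a) lqr \<Rightarrow> real" where
  "b_sigma M M' =
     Max {(max_singular_value (closed_loop M (opt_gain M)))\<^sup>2,
          (max_singular_value (closed_loop M (opt_gain M')))\<^sup>2,
          (max_singular_value (closed_loop M' (opt_gain M')))\<^sup>2,
          (max_singular_value (closed_loop M (greedy_gain M M')))\<^sup>2}"

definition D_star :: "('s::finite, 'a::finite) lqr \<Rightarrow> ('s, 'a) lqr \<Rightarrow> real^'s^'s" where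
  "D_star M M' = riccati_op M (riccati_sol M') - riccati_sol M'"

definition D_policy :: "('s::finite, 'a::finite) lqr \<Rightarrow> ('s, 'a) lqr \<Rightarrow> real^'s^'s" where
  "D_policy M M' =
     (let K = opt_gain M'; P = riccati_sol M'; L = closed_loop M K in
      lqr_Q M + transpose K ** lqr_R M ** K + lqr_gamma M *\<^sub>R (transpose L ** P ** L) - P)"

definition d_Sigma :: "('s::finite, 'a::finite) lqr \<Rightarrow> ('s, 'a) lqr \<Rightarrow> real" where
  "d_Sigma M M' = lqr_gamma M * trace ((lqr_Sigma M - lqr_Sigma M') ** riccati_sol M')"

end

theory Submission
  imports Defs "HOL-Computational_Algebra.Fundamental_Theorem_Algebra"
begin

text \<open>
  Both terms of the bound come from comparing with the same function
  \<open>v(s) = s\<^sup>T P' s + c\<close>, where \<open>P'\<close> is the Riccati solution of the approximate model and \<open>c\<close> is its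
  constant term shifted by a multiple of the free parameter \<open>\<alpha>\<^sub>2\<close>. By the triangle inequality it
  suffices to bound the distance from \<open>v\<close> to the value of the policy and the distance from \<open>v\<close> to the
  optimal value.

  Applying one Bellman step of the true model to \<open>v\<close> changes it by a quadratic function: by
  \<open>s\<^sup>T D s + d\<close>, with \<open>D\<close> one of the two matrices of the theorem and \<open>d = d\<^sub>\<Sigma> + \<alpha>\<^sub>2\<close>. Since \<open>D\<close> is
  symmetric, this residual is at most \<open>max (\<rho>(D) / l) \<bar>d\<bar>\<close> times the weight
  (\<open>abs_quadratic_le_weight\<close>). On the other hand, if a quadratic function is bounded by \<open>N\<close> times the
  weight, its discounted expectation after one closed-loop step is bounded by \<open>\<gamma> \<kappa> N\<close> times the
  weight (\<open>expected_quad_form_contraction\<close>): the singular values control the deterministic part of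
  the step and the trace of the covariance controls the noise. Summing the geometric series gives the
  factor \<open>1 / (1 - \<gamma> \<kappa>)\<close>. For the policy this is applied to the values truncated at a finite horizon
  (\<open>policy_value_error\<close>); for the optimal value it is applied from above with the gain that is greedy
  for \<open>v\<close> and from below with the optimal gain (\<open>optimal_value_error\<close>).

  This argument needs the optimal value functions in closed form. By DP-solvability the optimal value is
  a fixed point of the optimal Bellman operator with finite weighted norm. Value iteration from
  \<open>0\<close> stays below it, and consists of quadratic functions whose matrices are the iterates of
  the Riccati operator; being increasing and bounded, these converge to a solution of the Riccati
  equation (\<open>riccati_iterates_converge\<close>). Detectability makes this solution unique
  (\<open>riccati_sol_eqI\<close>). In the other direction, following the gain of the solution contracts the
  weighted norm, which pushes the optimal value below the same quadratic function
  (\<open>optimal_value_quadratic\<close>).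

  Uniqueness rests on the fact that a matrix with spectral radius below 1 generates a stable linear
  recursion (\<open>stable_forced_recursion_tendsto_zero\<close>), and the value of a linear policy is obtained from
  the marginals of the trajectory measure at single times (\<open>traj_marginal\<close>).
\<close>

section \<open>Quadratic forms and extremal eigenvalues\<close>

definition quad_form :: "real^'n^'n \<Rightarrow> real^'n \<Rightarrow> real" where
  "quad_form X x = x \<bullet> (X *v x)"

lemma inner_transpose_mult: "(transpose A *v x) \<bullet> y = x \<bullet> (A *v y)"
  for A :: "real^'n^'m"
  by (simp add: dot_lmul_matrix)

lemma inner_symmetric_mult:
  fixes X :: "real^'n^'n"
  assumes "transpose X = X"
  shows "x \<bullet> (X *v y) = y \<bullet> (X *v x)"
  using inner_transpose_mult[of X x y] assms by (simp add: inner_commute)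

lemma quad_form_add: "quad_form (X + Y) x = quad_form X x + quad_form Y x"
  by (simp add: quad_form_def matrix_vector_mult_add_rdistrib inner_add_right)

lemma quad_form_diff: "quad_form (X - Y) x = quad_form X x - quad_form Y x"
  by (simp add: quad_form_def matrix_vector_mult_diff_rdistrib inner_diff_right)

lemma quad_form_scaleR: "quad_form (c *\<^sub>R X) x = c * quad_form X x"
  by (simp add: quad_form_def scaleR_matrix_vector_assoc[symmetric])

lemma quad_form_mat1: "quad_form (mat 1) x = x \<bullet> x"
  by (simp add: quad_form_def)

lemma quad_form_zero_matrix [simp]: "quad_form 0 x = 0"
  by (simp add: quad_form_def)

lemma quad_form_congruence:
  fixes A :: "real^'n^'m"
  shows "quad_form (transpose A ** X ** A) x = quad_form X (A *v x)"
  unfolding quad_form_def matrix_vector_mul_assoc[symmetric]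
  by (metis inner_commute inner_transpose_mult)

lemma quad_form_scaled_vector: "quad_form X (c *\<^sub>R x) = c\<^sup>2 * quad_form X x"
  by (simp add: quad_form_def matrix_vector_mult_scaleR power2_eq_square)

lemma quad_form_plus:
  assumes "transpose X = X"
  shows "quad_form X (x + y) = quad_form X x + 2 * (y \<bullet> (X *v x)) + quad_form X y"
  using inner_symmetric_mult[OF assms, of x y]
  by (simp add: quad_form_def matrix_vector_right_distrib inner_add_left inner_add_right)

lemma transpose_add: "transpose (X + Y) = transpose X + transpose Y"
  for X :: "'a::plus^'n^'m"
  by (simp add: transpose_def vec_eq_iff)

lemma transpose_diff: "transpose (X - Y) = transpose X - transpose Y"
  for X :: "'a::minus^'n^'m"
  by (simp add: transpose_def vec_eq_iff)

lemma transpose_zero [simp]: "transpose (0 :: 'a::zero^'n^'m) = 0"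
  by (simp add: transpose_def vec_eq_iff)

lemma transpose_congruence:
  fixes A :: "real^'n^'m"
  shows "transpose X = X \<Longrightarrow> transpose (transpose A ** X ** A) = transpose A ** X ** A"
  by (simp add: matrix_transpose_mul matrix_mul_assoc)

lemma psd_mat_alt: "psd_mat X \<longleftrightarrow> transpose X = X \<and> (\<forall>x. 0 \<le> quad_form X x)"
  by (simp add: psd_mat_def quad_form_def)

lemma pd_mat_alt: "pd_mat X \<longleftrightarrow> transpose X = X \<and> (\<forall>x. x \<noteq> 0 \<longrightarrow> 0 < quad_form X x)"
  by (simp add: pd_mat_def quad_form_def)

text \<open>
  Symmetric matrices are determined by their quadratic forms, entry by entry; this carries both
  equality and convergence from quadratic forms to matrices.
\<close>

lemma symmetric_entry_polarization:
  fixes X :: "real^'n^'n"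
  assumes "transpose X = X"
  shows "X $ i $ j =
    (quad_form X (axis i 1 + axis j 1) - quad_form X (axis i 1) - quad_form X (axis j 1)) / 2"
proof -
  have "axis j 1 \<bullet> (X *v axis i 1) = X $ j $ i"
    by (simp add: inner_axis' matrix_vector_mult_basis column_def)
  moreover have "X $ j $ i = X $ i $ j"
    using assms by (metis transpose_def vec_lambda_beta)
  ultimately show ?thesis
    by (simp add: quad_form_plus[OF assms])
qed

lemma symmetric_eqI:
  fixes X Y :: "real^'n^'n"
  assumes "transpose X = X" "transpose Y = Y" "\<And>x. quad_form X x = quad_form Y x"
  shows "X = Y"
  unfolding vec_eq_iff by (simp add: assms symmetric_entry_polarization)

lemma quad_form_entries: "quad_form X x = (\<Sum>i\<in>UNIV. \<Sum>j\<in>UNIV. X $ i $ j * (x $ i * x $ j))"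
  by (simp add: quad_form_def inner_vec_def matrix_vector_mult_def sum_distrib_left mult_ac)

text \<open>
  A crude matrix norm: it bounds the quadratic form and all eigenvalues at once, and its continuity
  in the entries is evident.
\<close>

definition entry_sum :: "real^'n^'n \<Rightarrow> real" where
  "entry_sum X = (\<Sum>i\<in>UNIV. \<Sum>j\<in>UNIV. \<bar>X $ i $ j\<bar>)"

lemma entry_sum_nonneg: "0 \<le> entry_sum X"
  by (simp add: entry_sum_def sum_nonneg)

lemma abs_quad_form_le_entry_sum: "\<bar>quad_form X x\<bar> \<le> entry_sum X * (x \<bullet> x)"
proof -
  have "\<bar>x $ i * x $ j\<bar> \<le> x \<bullet> x" for i j
    unfolding abs_mult dot_square_norm power2_eq_square
    by (intro mult_mono component_le_norm_cart) auto
  then have "\<bar>X $ i $ j * (x $ i * x $ j)\<bar> \<le> \<bar>X $ i $ j\<bar> * (x \<bullet> x)" for i j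
    by (simp add: abs_mult mult_left_mono del: mult_le_cancel_left)
  then show ?thesis
    unfolding quad_form_entries entry_sum_def sum_distrib_right
    by (intro order.trans[OF sum_abs] sum_mono)
qed

lemma quad_form_continuous: "continuous_on S (quad_form X)"
  unfolding quad_form_def by (intro continuous_intros)

text \<open>
  A zero of a nonnegative quadratic form is a minimum, so the gradient \<open>2 T v\<close> vanishes there.
\<close>

lemma psd_kernel:
  assumes "psd_mat T" "quad_form T v = 0"
  shows "T *v v = 0"
proof (rule ccontr)
  assume ne: "T *v v \<noteq> 0"
  define y where "y = T *v v"
  define c where "c = quad_form T y"
  have sym: "transpose T = T" and nn: "0 \<le> quad_form T x" for x
    using assms by (auto simp: psd_mat_alt)
  have yy: "0 < y \<bullet> y" using ne by (simp add: y_def)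
  have q: "0 \<le> 2 * t * (y \<bullet> y) + t\<^sup>2 * c" for t
    using nn[of "v + t *\<^sub>R y"] assms(2)
    by (simp add: quad_form_plus[OF sym] quad_form_scaled_vector c_def y_def)
  have c: "0 \<le> c" using nn by (simp add: c_def)
  \<comment> \<open>Moving from \<open>v\<close> by a small negative multiple of \<open>T v\<close> would make the form negative.\<close>
  define r where "r = 1 / (c + 1)"
  have r: "0 < r" "r * c < 1" using c by (auto simp: r_def)
  have "0 \<le> 2 * (- r * (y \<bullet> y)) * (y \<bullet> y) + (- r * (y \<bullet> y))\<^sup>2 * c"
    by (rule q)
  also have "\<dots> = (y \<bullet> y)\<^sup>2 * r * (r * c - 2)"
    by (simp add: algebra_simps power2_eq_square)
  also have "\<dots> < 0"
    using r yy by (intro mult_pos_neg) auto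
  finally show False by simp
qed

text \<open>
  Maximise the quadratic form over the unit sphere. With the maximum \<open>\<mu>\<close> attained at \<open>v\<close>, the matrix
  \<open>\<mu> I - S\<close> is positive semidefinite and its form vanishes at \<open>v\<close>, so \<open>v\<close> lies in its kernel.
\<close>

lemma symmetric_max_eigenvector:
  fixes S :: "real^'n^'n"
  assumes "transpose S = S"
  obtains v \<mu> where "v \<noteq> 0" "S *v v = \<mu> *\<^sub>R v" "\<And>x. quad_form S x \<le> \<mu> * (x \<bullet> x)"
proof -
  have "compact (sphere (0::real^'n) 1)" "sphere (0::real^'n) 1 \<noteq> {}" by auto
  then obtain v where v: "v \<in> sphere 0 1"
    and max: "\<And>x. x \<in> sphere 0 1 \<Longrightarrow> quad_form S x \<le> quad_form S v"
    using continuous_attains_sup[OF _ _ quad_form_continuous[of "sphere 0 1" S]] by metis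
  define \<mu> where "\<mu> = quad_form S v"
  \<comment> \<open>Homogeneity extends the maximum from the sphere to all vectors.\<close>
  have le: "quad_form S x \<le> \<mu> * (x \<bullet> x)" for x
  proof (cases "x = 0")
    case False
    have "quad_form S ((1 / norm x) *\<^sub>R x) \<le> \<mu>"
      unfolding \<mu>_def using False by (intro max) auto
    then show ?thesis
      using False by (simp add: quad_form_scaled_vector dot_square_norm field_simps)
  qed (simp add: quad_form_def)
  have "psd_mat (\<mu> *\<^sub>R mat 1 - S)"
    using le assms
    by (simp add: psd_mat_alt quad_form_diff quad_form_scaleR quad_form_mat1 transpose_diff
        transpose_scalar)
  moreover have "quad_form (\<mu> *\<^sub>R mat 1 - S) v = 0"
    using v by (simp add: quad_form_diff quad_form_scaleR quad_form_mat1 \<mu>_def dot_square_norm)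
  ultimately have "(\<mu> *\<^sub>R mat 1 - S) *v v = 0"
    by (rule psd_kernel)
  then have "S *v v = \<mu> *\<^sub>R v"
    by (simp add: matrix_vector_mult_diff_rdistrib scaleR_matrix_vector_assoc[symmetric])
  moreover have "v \<noteq> 0" using v by auto
  ultimately show ?thesis using le that by blast
qed

text \<open>
  Evaluate the eigenvalue equation at a component of largest modulus of the eigenvector. The bound is
  what makes the supremum in the definition of the spectral radius an upper bound.
\<close>

lemma mat_spectrum_bounded:
  fixes X :: "real^'n^'n"
  assumes "z \<in> mat_spectrum X"
  shows "cmod z \<le> entry_sum X"
proof -
  obtain v :: "complex^'n" where v: "v \<noteq> 0" "map_matrix complex_of_real X *v v = z *s v"
    using assms by (auto simp: mat_spectrum_def)
  have "Max (range (\<lambda>i. cmod (v $ i))) \<in> range (\<lambda>i. cmod (v $ i))"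
    by (intro Max_in) auto
  then obtain i where "cmod (v $ i) = Max (range (\<lambda>i. cmod (v $ i)))"
    by (metis rangeE)
  then have i: "cmod (v $ j) \<le> cmod (v $ i)" for j
    by (simp add: Max_ge)
  have pos: "0 < cmod (v $ i)"
  proof (rule ccontr)
    assume "\<not> ?thesis"
    then have "v $ j = 0" for j using i[of j] by simp
    then show False using v(1) by (simp add: vec_eq_iff)
  qed
  have "z * v $ i = (\<Sum>j\<in>UNIV. of_real (X $ i $ j) * v $ j)"
    using arg_cong[OF v(2), of "\<lambda>u. u $ i"] by (simp add: matrix_vector_mult_def)
  then have "cmod z * cmod (v $ i) = cmod (\<Sum>j\<in>UNIV. of_real (X $ i $ j) * v $ j)"
    by (metis norm_mult)
  also have "\<dots> \<le> (\<Sum>j\<in>UNIV. \<bar>X $ i $ j\<bar> * cmod (v $ i))"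
    by (intro sum_norm_le) (auto simp: norm_mult intro!: mult_left_mono i)
  also have "\<dots> \<le> entry_sum X * cmod (v $ i)"
    unfolding sum_distrib_right[symmetric] entry_sum_def
    by (intro mult_right_mono member_le_sum[of i UNIV "\<lambda>i. \<Sum>j\<in>UNIV. \<bar>X $ i $ j\<bar>"])
       (auto simp: sum_nonneg)
  finally show ?thesis using pos by simp
qed

lemma cmod_le_mat_spectral_radius:
  assumes "z \<in> mat_spectrum X"
  shows "cmod z \<le> mat_spectral_radius X"
  unfolding mat_spectral_radius_def
  by (intro cSUP_upper assms bdd_aboveI2[where M = "entry_sum X"] mat_spectrum_bounded)

lemma abs_real_eigenvalue_le_mat_spectral_radius:
  fixes X :: "real^'n^'n"
  assumes "v \<noteq> 0" "X *v v = \<mu> *\<^sub>R v"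
  shows "\<bar>\<mu>\<bar> \<le> mat_spectral_radius X"
proof -
  define w :: "complex^'n" where "w = (\<chi> i. of_real (v $ i))"
  have "map_matrix complex_of_real X *v w = complex_of_real \<mu> *s w"
    unfolding vec_eq_iff
  proof
    fix i
    have "(\<Sum>j\<in>UNIV. X $ i $ j * v $ j) = \<mu> * v $ i"
      using arg_cong[OF assms(2), of "\<lambda>u. u $ i"] by (simp add: matrix_vector_mult_def)
    then show "(map_matrix complex_of_real X *v w) $ i = (complex_of_real \<mu> *s w) $ i"
      by (simp add: w_def matrix_vector_mult_def flip: of_real_mult of_real_sum)
  qed
  moreover have "w \<noteq> 0" using assms(1) by (auto simp: w_def vec_eq_iff)
  ultimately have "complex_of_real \<mu> \<in> mat_spectrum X"
    unfolding mat_spectrum_def by blast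
  from cmod_le_mat_spectral_radius[OF this] show ?thesis by simp
qed

text \<open>
  The extremal values of the form of \<open>D\<close> on the unit sphere, from above and from below, are
  eigenvalues of \<open>D\<close>.
\<close>

lemma abs_quad_form_le_mat_spectral_radius:
  fixes D :: "real^'n^'n"
  assumes "transpose D = D"
  shows "\<bar>quad_form D x\<bar> \<le> mat_spectral_radius D * (x \<bullet> x)"
proof -
  have neg: "transpose (- D) = - D" using assms by (simp add: transpose_def vec_eq_iff)
  obtain v \<mu> where 1: "v \<noteq> 0" "D *v v = \<mu> *\<^sub>R v" "\<And>x. quad_form D x \<le> \<mu> * (x \<bullet> x)"
    using symmetric_max_eigenvector[OF assms] by metis
  obtain v' \<mu>' where 2: "v' \<noteq> 0" "- D *v v' = \<mu>' *\<^sub>R v'"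
      "\<And>x. quad_form (- D) x \<le> \<mu>' * (x \<bullet> x)"
    using symmetric_max_eigenvector[OF neg] by metis
  have "D *v v' = (- \<mu>') *\<^sub>R v'"
    using 2(2) matrix_vector_mult_diff_rdistrib[of 0 D v'] by (simp add: neg_equal_iff_equal minus_equation_iff)
  from abs_real_eigenvalue_le_mat_spectral_radius[OF 2(1) this]
    abs_real_eigenvalue_le_mat_spectral_radius[OF 1(1,2)]
  have "\<mu> \<le> mat_spectral_radius D" "\<mu>' \<le> mat_spectral_radius D" by auto
  moreover have "quad_form (- D) x = - quad_form D x"
    using quad_form_scaleR[of "-1" D x] by simp
  ultimately show ?thesis
    using 1(3)[of x] 2(3)[of x] mult_right_mono[of \<mu> _ "x \<bullet> x"] mult_right_mono[of \<mu>' _ "x \<bullet> x"]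
    by (smt (verit) inner_ge_zero)
qed

text \<open>
  The squared norm of \<open>X x\<close> is the quadratic form of \<open>X\<^sup>T X\<close>, whose largest eigenvalue is the square of a
  singular value.
\<close>

lemma norm_mult_le_max_singular_value:
  fixes X :: "real^'n^'m"
  shows "(X *v x) \<bullet> (X *v x) \<le> (max_singular_value X)\<^sup>2 * (x \<bullet> x)"
proof -
  define S where "S = transpose X ** X"
  have form: "quad_form S y = (X *v y) \<bullet> (X *v y)" for y
    unfolding S_def using quad_form_congruence[of X "mat 1" y] by (simp add: quad_form_mat1)
  have "transpose S = S" by (simp add: S_def matrix_transpose_mul)
  then obtain v \<mu> where v: "v \<noteq> 0" "S *v v = \<mu> *\<^sub>R v"
    and le: "\<And>x. quad_form S x \<le> \<mu> * (x \<bullet> x)"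
    using symmetric_max_eigenvector by metis
  have "\<mu> * (v \<bullet> v) = quad_form S v" using v by (simp add: quad_form_def)
  then have "0 \<le> \<mu> * (v \<bullet> v)" by (simp add: form)
  moreover have "0 < v \<bullet> v" using v(1) by simp
  ultimately have \<mu>: "0 \<le> \<mu>" by (metis mult_neg_pos not_le)
  have mem: "sqrt \<mu> \<in> singular_values X"
    using v \<mu> by (auto simp: singular_values_def S_def)
  have "bdd_above (singular_values X)"
  proof (rule bdd_aboveI[where M = "sqrt \<mu>"])
    fix \<sigma> assume "\<sigma> \<in> singular_values X"
    then obtain y where y: "0 \<le> \<sigma>" "y \<noteq> 0" "S *v y = \<sigma>\<^sup>2 *\<^sub>R y"
      by (auto simp: singular_values_def S_def)
    have "\<sigma>\<^sup>2 * (y \<bullet> y) \<le> \<mu> * (y \<bullet> y)"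
      using le[of y] y by (simp add: quad_form_def)
    moreover have "0 < y \<bullet> y" using y by simp
    ultimately have "\<sigma>\<^sup>2 \<le> \<mu>" by (simp only: mult_le_cancel_right_pos)
    then show "\<sigma> \<le> sqrt \<mu>"
      by (rule real_le_rsqrt)
  qed
  then have "sqrt \<mu> \<le> max_singular_value X"
    unfolding max_singular_value_def by (intro cSup_upper mem)
  then have "(sqrt \<mu>)\<^sup>2 \<le> (max_singular_value X)\<^sup>2"
    using \<mu> by (intro power_mono) auto
  then have "\<mu> \<le> (max_singular_value X)\<^sup>2"
    using \<mu> by simp
  then have "\<mu> * (x \<bullet> x) \<le> (max_singular_value X)\<^sup>2 * (x \<bullet> x)"
    by (intro mult_right_mono) auto
  with le[of x] show ?thesis by (simp add: form)
qed

section \<open>Stable linear recursions with vanishing input\<close>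

text \<open>
  Once the input is below \<open>(1 - r) e / 2\<close>, the value \<open>e / 2\<close> is a fixed point of the dominating
  recursion, and the excess over it decays geometrically.
\<close>

lemma linear_recursion_tendsto_zero:
  fixes a b :: "nat \<Rightarrow> real"
  assumes rec: "\<And>t. a (Suc t) \<le> r * a t + b t" and nn: "\<And>t. 0 \<le> a t"
    and r: "0 \<le> r" "r < 1" and b: "b \<longlonglongrightarrow> 0"
  shows "a \<longlonglongrightarrow> 0"
proof (rule LIMSEQ_I)
  fix e :: real assume e: "0 < e"
  have "0 < (1 - r) * (e / 2)" using e r by simp
  then obtain N where N: "\<And>t. t \<ge> N \<Longrightarrow> b t < (1 - r) * (e / 2)"
    using LIMSEQ_D[OF b] by (metis abs_ge_self diff_zero le_less_trans real_norm_def)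
  have bound: "a (N + k) \<le> e / 2 + r ^ k * a N" for k
  proof (induction k)
    case (Suc k)
    have "a (N + Suc k) \<le> r * a (N + k) + (1 - r) * (e / 2)"
      using rec[of "N + k"] N[of "N + k"] by simp
    also have "\<dots> \<le> r * (e / 2 + r ^ k * a N) + (1 - r) * (e / 2)"
      using Suc r by (intro add_right_mono mult_left_mono) auto
    also have "\<dots> = e / 2 + r ^ Suc k * a N" by (simp add: field_simps)
    finally show ?case .
  qed (use e in simp)
  have "(\<lambda>k. r ^ k * a N) \<longlonglongrightarrow> 0"
    using r by (intro tendsto_mult_left_zero LIMSEQ_realpow_zero) auto
  then obtain L where L: "\<And>k. k \<ge> L \<Longrightarrow> r ^ k * a N < e / 2"
    using order_tendstoD(2)[of _ 0 sequentially "e / 2"] e unfolding eventually_sequentially by auto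
  have "norm (a n - 0) < e" if "n \<ge> N + L" for n
  proof -
    have "L \<le> n - N" "N + (n - N) = n" using that by auto
    then show ?thesis using bound[of "n - N"] L[of "n - N"] nn[of n] by simp
  qed
  then show "\<exists>no. \<forall>n\<ge>no. norm (a n - 0) < e" by blast
qed

text \<open>
  Stated for sequences, so that a repeated vector counts as a dependence even if the set of values is
  independent.
\<close>

lemma ex_linear_dependence:
  fixes f :: "nat \<Rightarrow> 'a::euclidean_space"
  obtains c :: "nat \<Rightarrow> real" and N where "\<exists>i\<le>N. c i \<noteq> 0" "(\<Sum>i\<le>N. c i *\<^sub>R f i) = 0"
proof (cases "inj_on f {..DIM('a)}")
  case True
  then have "card (f ` {..DIM('a)}) > DIM('a)" by (simp add: card_image)
  then have "dependent (f ` {..DIM('a)})"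
    using independent_bound by (metis not_le)
  then obtain u v where "v \<in> f ` {..DIM('a)}" "u v \<noteq> 0"
    and 0: "(\<Sum>v\<in>f ` {..DIM('a)}. u v *\<^sub>R v) = 0"
    by (subst (asm) dependent_finite) auto
  then have "\<exists>i\<le>DIM('a). u (f i) \<noteq> 0" by auto
  moreover have "(\<Sum>i\<le>DIM('a). u (f i) *\<^sub>R f i) = 0"
    using 0 by (simp add: sum.reindex[OF True])
  ultimately show ?thesis by (rule that[of "DIM('a)" "\<lambda>i. u (f i)"])
next
  case False
  then obtain i j where ij: "i \<le> DIM('a)" "j \<le> DIM('a)" "i \<noteq> j" "f i = f j"
    by (auto simp: inj_on_def)
  define c :: "nat \<Rightarrow> real" where "c k = (if k = i then 1 else 0) - (if k = j then 1 else 0)" for k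
  have "(\<Sum>k\<le>DIM('a). c k *\<^sub>R f k) =
      (\<Sum>k\<le>DIM('a). if k = i then f k else 0) - (\<Sum>k\<le>DIM('a). if k = j then f k else 0)"
    unfolding sum_subtractf[symmetric] by (intro sum.cong) (auto simp: c_def)
  also have "\<dots> = 0" using ij by (simp add: sum.delta)
  finally show ?thesis using ij by (intro that[of "DIM('a)" c]) (auto simp: c_def)
qed

text \<open>
  The vector \<open>p(G) x\<close>.
\<close>

definition poly_action :: "complex poly \<Rightarrow> complex^'n^'n \<Rightarrow> complex^'n \<Rightarrow> complex^'n" where
  "poly_action p G x = (\<Sum>i\<le>degree p. coeff p i *s (((*v) G ^^ i) x))"

lemma poly_action_upto:
  assumes "degree p \<le> N"
  shows "poly_action p G x = (\<Sum>i\<le>N. coeff p i *s (((*v) G ^^ i) x))"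
  unfolding poly_action_def
  by (rule sum.mono_neutral_left) (use assms in \<open>auto simp: coeff_eq_0\<close>)

lemma poly_action_pCons: "poly_action (pCons a p) G x = a *s x + poly_action p G (G *v x)"
proof -
  have "poly_action (pCons a p) G x
      = (\<Sum>i\<le>Suc (degree p). coeff (pCons a p) i *s (((*v) G ^^ i) x))"
    by (rule poly_action_upto) (rule degree_pCons_le)
  also have "\<dots> = a *s x + poly_action p G (G *v x)"
    by (simp add: sum.atMost_Suc_shift poly_action_def funpow_swap1 del: sum.atMost_Suc)
  finally show ?thesis .
qed

lemma poly_action_zero [simp]: "poly_action 0 G x = 0"
  by (simp add: poly_action_def)

lemma poly_action_linear:
  "poly_action p G (x + y) = poly_action p G x + poly_action p G y"
  "poly_action p G (c *s x) = c *s poly_action p G x"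
  by (induction p arbitrary: x y)
     (simp_all add: poly_action_pCons matrix_vector_right_distrib vec.scale_right_distrib
       vector_smult_assoc mult.commute vector_scalar_commute)

lemma poly_action_commute: "poly_action p G (G *v x) = G *v poly_action p G x"
  by (induction p arbitrary: x)
     (simp_all add: poly_action_pCons matrix_vector_right_distrib vector_scalar_commute)

lemma poly_action_add_smult:
  "poly_action (p + q) G x = poly_action p G x + poly_action q G x"
  "poly_action (smult c p) G x = c *s poly_action p G x"
proof -
  show "poly_action (p + q) G x = poly_action p G x + poly_action q G x"
    by (induction p q arbitrary: x rule: poly_induct2)
       (simp_all add: poly_action_pCons vec.scale_left_distrib)
  show "poly_action (smult c p) G x = c *s poly_action p G x"
    by (induction p arbitrary: x)
       (simp_all add: poly_action_pCons vec.scale_right_distrib vector_smult_assoc)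
qed

lemma poly_action_linear_factor:
  "poly_action ([:-z, 1:] * q) G x = G *v poly_action q G x - z *s poly_action q G x"
proof -
  have "[:-z, 1:] * q = pCons 0 q + smult (- z) q" by simp
  then show ?thesis
    by (simp only: poly_action_add_smult poly_action_pCons poly_action_commute) simp
qed

text \<open>
  The powers of \<open>G\<close> lie in a finite-dimensional space of matrices, so they are linearly dependent.
\<close>

lemma ex_annihilating_poly:
  fixes G :: "complex^'n^'n"
  obtains p where "p \<noteq> 0" "\<And>x. poly_action p G x = 0"
proof -
  define f where "f i = ((\<lambda>X. G ** X) ^^ i) (mat 1)" for i
  have f: "f i *v x = ((*v) G ^^ i) x" for i x
    by (induction i) (simp_all add: f_def matrix_vector_mul_assoc[symmetric])
  obtain c :: "nat \<Rightarrow> real" and N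
    where c: "\<exists>i\<le>N. c i \<noteq> 0" "(\<Sum>i\<le>N. c i *\<^sub>R f i) = 0"
    using ex_linear_dependence[of f] by metis
  define p where "p = (\<Sum>i\<le>N. monom (complex_of_real (c i)) i)"
  have co: "coeff p i = (if i \<le> N then of_real (c i) else 0)" for i
    by (simp add: p_def coeff_sum)
  have scale: "(r *\<^sub>R F) *v x = of_real r *s (F *v x)" for r and F :: "complex^'n^'n" and x
    by (simp add: vec_eq_iff matrix_vector_mult_def sum_distrib_left
        scaleR_conv_of_real[where 'a = complex] mult_ac)
  have deg: "degree p \<le> N"
    by (rule degree_le) (simp add: co)
  have "p \<noteq> 0"
    using c(1) co by (metis coeff_0 of_real_eq_0_iff)
  moreover have "poly_action p G x = 0" for x
  proof -
    have "poly_action p G x = (\<Sum>i\<le>N. of_real (c i) *s (f i *v x))"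
      unfolding poly_action_upto[OF deg] by (intro sum.cong) (auto simp: co f)
    also have "\<dots> = (\<Sum>i\<le>N. c i *\<^sub>R f i) *v x"
      by (induction N) (simp_all add: matrix_vector_mult_add_rdistrib scale)
    finally show ?thesis by (simp add: c(2))
  qed
  ultimately show ?thesis by (rule that)
qed

lemma tendsto_smult_vec: "(f \<longlonglongrightarrow> l) \<Longrightarrow> (\<lambda>t. z *s f t) \<longlonglongrightarrow> z *s l"
  for f :: "nat \<Rightarrow> complex^'n"
  by (intro vec_tendstoI) (simp add: tendsto_mult tendsto_vec_nth)

lemma tendsto_matrix_vector_mult:
  fixes G :: "'b::{real_normed_algebra_1}^'n^'m"
  shows "(f \<longlonglongrightarrow> l) \<Longrightarrow> (\<lambda>t. G *v f t) \<longlonglongrightarrow> G *v l"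
  by (intro vec_tendstoI)
     (simp add: matrix_vector_mult_def tendsto_sum tendsto_mult tendsto_vec_nth)

lemma norm_smult_vec: "norm (z *s x) = cmod z * norm x" for x :: "complex^'n"
  by (simp add: norm_vec_def norm_mult L2_set_right_distrib)

text \<open>
  Induction on the degree of a polynomial annihilating the sequence \<open>x\<close>. Split off a root \<open>z\<close>. If
  \<open>\<bar>z\<bar> < 1\<close>, the sequence \<open>y = (G - z) x\<close> obeys a recursion of the same kind and is annihilated by the
  cofactor, so it tends to zero; then \<open>x\<close> obeys \<open>x\<^bsub>t+1\<^esub> = z x\<^bsub>t\<^esub> + (y\<^bsub>t\<^esub> + u\<^bsub>t\<^esub>)\<close>. If \<open>\<bar>z\<bar> \<ge> 1\<close>, then \<open>z\<close>
  is not an eigenvalue, \<open>G - z\<close> is injective, and the cofactor annihilates \<open>x\<close> itself.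
\<close>

lemma annihilated_forced_recursion_tendsto_zero:
  fixes G :: "complex^'n^'n" and x u :: "nat \<Rightarrow> complex^'n"
  assumes stable: "\<And>z v. v \<noteq> 0 \<Longrightarrow> G *v v = z *s v \<Longrightarrow> cmod z < 1"
    and "p \<noteq> 0" and "\<And>t. poly_action p G (x t) = 0"
    and "\<And>t. x (Suc t) = G *v x t + u t" and "u \<longlonglongrightarrow> 0"
  shows "x \<longlonglongrightarrow> 0"
  using assms(2-)
proof (induction "degree p" arbitrary: p x u)
  case 0
  then obtain a where "p = [:a:]" "a \<noteq> 0"
    by (metis degree_eq_zeroE pCons_0_0)
  then have "x t = 0" for t using 0(3)[of t] by (simp add: poly_action_pCons)
  then have "x = (\<lambda>_. 0)" by auto
  then show ?case by simp
next
  case (Suc n)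
  have "\<not> constant (poly p)" using Suc.hyps(2) by (simp add: constant_degree)
  then obtain z where "poly p z = 0" using fundamental_theorem_of_algebra by blast
  then obtain q where p: "p = [:-z, 1:] * q" by (auto simp: poly_eq_0_iff_dvd)
  then have q0: "q \<noteq> 0" using Suc.prems(1) by auto
  then have "degree p = Suc (degree q)" unfolding p by (subst degree_mult_eq) auto
  with q0 Suc.hyps(2) have q: "q \<noteq> 0" "n = degree q" by auto
  have ker: "G *v poly_action q G (x t) - z *s poly_action q G (x t) = 0" for t
    using Suc.prems(2)[of t] unfolding p poly_action_linear_factor .
  show ?case
  proof (cases "cmod z < 1")
    case True
    define y where "y t = G *v x t - z *s x t" for t
    define u' where "u' t = G *v u t - z *s u t" for t
    have "y \<longlonglongrightarrow> 0"
    proof (rule Suc.hyps(1)[OF q(2) q(1)])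
      show "poly_action q G (y t) = 0" for t
        using ker[of t] poly_action_linear(1)[of q G "y t" "z *s x t"]
        by (simp add: y_def poly_action_commute poly_action_linear)
      show "y (Suc t) = G *v y t + u' t" for t
        by (simp add: y_def u'_def Suc.prems(3) matrix_vector_right_distrib
            matrix_vector_mult_diff_distrib vector_scalar_commute vec.scale_right_distrib)
      show "u' \<longlonglongrightarrow> 0"
        unfolding u'_def
        using tendsto_diff[OF tendsto_matrix_vector_mult[OF Suc.prems(4), of G]
            tendsto_smult_vec[OF Suc.prems(4), of z]] by simp
    qed
    then have b: "(\<lambda>t. norm (y t + u t)) \<longlonglongrightarrow> 0"
      using tendsto_norm[OF tendsto_add[OF _ Suc.prems(4)], of y 0] by simp
    have "norm (x (Suc t)) \<le> cmod z * norm (x t) + norm (y t + u t)" for t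
    proof -
      have "x (Suc t) = z *s x t + (y t + u t)" by (simp add: y_def Suc.prems(3))
      then show ?thesis by (metis norm_smult_vec norm_triangle_ineq)
    qed
    then have "(\<lambda>t. norm (x t)) \<longlonglongrightarrow> 0"
      by (rule linear_recursion_tendsto_zero) (use True b in auto)
    then show ?thesis by (rule tendsto_norm_zero_cancel)
  next
    case False
    then have "poly_action q G (x t) = 0" for t
      using stable[of "poly_action q G (x t)" z] ker[of t] by auto
    then show ?thesis by (rule Suc.hyps(1)[OF q(2) q(1) _ Suc.prems(3,4)])
  qed
qed

text \<open>
  Eigenvalues are complex, so the recursion is read in the complexified space.
\<close>

lemma stable_forced_recursion_tendsto_zero:
  fixes G :: "real^'n^'n" and x u :: "nat \<Rightarrow> real^'n"
  assumes "mat_spectral_radius G < 1"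
    and rec: "\<And>t. x (Suc t) = G *v x t + u t" and u: "u \<longlonglongrightarrow> 0"
  shows "x \<longlonglongrightarrow> 0"
proof -
  define cv :: "real^'n \<Rightarrow> complex^'n" where "cv x = (\<chi> i. of_real (x $ i))" for x
  define Gc where "Gc = map_matrix complex_of_real G"
  have ev: "cmod z < 1" if "v \<noteq> 0" "Gc *v v = z *s v" for z v
  proof -
    have "z \<in> mat_spectrum G" using that by (auto simp: mat_spectrum_def Gc_def)
    with cmod_le_mat_spectral_radius[OF this] assms(1) show ?thesis by simp
  qed
  obtain p where p: "p \<noteq> 0" "\<And>x. poly_action p Gc x = 0"
    using ex_annihilating_poly[of Gc] by metis
  have cvrec: "cv (x (Suc t)) = Gc *v cv (x t) + cv (u t)" for t
    unfolding rec by (simp add: cv_def Gc_def vec_eq_iff matrix_vector_mult_def)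
  have cvu: "(\<lambda>t. cv (u t)) \<longlonglongrightarrow> 0"
  proof (rule vec_tendstoI)
    fix i
    show "(\<lambda>t. cv (u t) $ i) \<longlonglongrightarrow> 0 $ i"
      using tendsto_of_real[OF tendsto_vec_nth[OF u, of i], where 'a = complex] by (simp add: cv_def)
  qed
  have lim: "(\<lambda>t. cv (x t)) \<longlonglongrightarrow> 0"
    by (rule annihilated_forced_recursion_tendsto_zero[OF ev p cvrec cvu])
  show ?thesis
  proof (rule vec_tendstoI)
    fix i
    have "(\<lambda>t. complex_of_real (x t $ i)) \<longlonglongrightarrow> of_real 0"
      using tendsto_vec_nth[OF lim, of i] by (simp add: cv_def)
    then show "(\<lambda>t. x t $ i) \<longlonglongrightarrow> 0 $ i"
      by (simp add: tendsto_of_real_iff del: of_real_0)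
  qed
qed

section \<open>The Riccati operator as a one-step minimisation\<close>

lemma matrix_inv_inverse:
  fixes G :: "real^'n^'n"
  assumes "invertible G"
  shows "G ** matrix_inv G = mat 1" "matrix_inv G ** G = mat 1"
  using assms someI_ex[of "\<lambda>A'. G ** A' = mat 1 \<and> A' ** G = mat 1"]
  by (auto simp: invertible_def matrix_inv_def)

lemma pd_mat_invertible:
  fixes G :: "real^'n^'n"
  assumes "pd_mat G"
  shows "invertible G"
  unfolding invertible_left_inverse matrix_left_invertible_ker
proof (intro allI impI)
  fix x assume "G *v x = 0"
  then have "x \<bullet> (G *v x) = 0" by simp
  then show "x = 0" using assms by (metis less_irrefl pd_mat_def)
qed

lemma transpose_matrix_inv:
  fixes G :: "real^'n^'n"
  assumes "invertible G" "transpose G = G"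
  shows "transpose (matrix_inv G) = matrix_inv G"
proof -
  have "transpose (matrix_inv G) ** G = mat 1"
    using arg_cong[OF matrix_inv_inverse(1)[OF assms(1)], of transpose] assms(2)
    by (simp add: matrix_transpose_mul)
  then have "transpose (matrix_inv G) ** (G ** matrix_inv G) = matrix_inv G"
    by (simp add: matrix_mul_assoc)
  then show ?thesis by (simp add: matrix_inv_inverse[OF assms(1)])
qed

text \<open>
  The smallest eigenvalue of a positive definite matrix is positive.
\<close>

lemma pd_mat_lower_bound:
  fixes R :: "real^'n^'n"
  assumes "pd_mat R"
  obtains r where "0 < r" "\<And>x. r * (x \<bullet> x) \<le> quad_form R x"
proof -
  have "transpose (- R) = - R" using assms by (simp add: pd_mat_def transpose_def vec_eq_iff)
  then obtain v \<mu> where v: "v \<noteq> 0" "- R *v v = \<mu> *\<^sub>R v"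
    and le: "\<And>x. quad_form (- R) x \<le> \<mu> * (x \<bullet> x)"
    using symmetric_max_eigenvector by metis
  have neg: "quad_form (- R) x = - quad_form R x" for x
    using quad_form_scaleR[of "-1" R x] by simp
  have "\<mu> * (v \<bullet> v) = quad_form (- R) v"
    unfolding quad_form_def by (simp only: v(2) inner_scaleR_right)
  also have "\<dots> < 0" using assms v(1) by (simp add: pd_mat_alt neg)
  finally have "\<mu> < 0" by (smt (verit) inner_ge_zero mult_nonneg_nonneg)
  then show ?thesis using that[of "- \<mu>"] le neg by (simp add: minus_le_iff)
qed

text \<open>
  Half the Hessian, in the action, of the cost of one step followed by the discounted terminal cost
  \<open>s\<^sup>T X s\<close>.
\<close>

definition control_curvature :: "('s::finite, 'a::finite) lqr \<Rightarrow> real^'s^'s \<Rightarrow> real^'a^'a" where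
  "control_curvature M X = lqr_R M + lqr_gamma M *\<^sub>R (transpose (lqr_B M) ** X ** lqr_B M)"

definition riccati_gain :: "('s::finite, 'a::finite) lqr \<Rightarrow> real^'s^'s \<Rightarrow> real^'s^'a" where
  "riccati_gain M X =
     lqr_gamma M *\<^sub>R (matrix_inv (control_curvature M X) ** transpose (lqr_B M) ** X ** lqr_A M)"

lemma opt_gain_riccati_gain: "opt_gain M = riccati_gain M (riccati_sol M)"
  by (simp add: opt_gain_def riccati_gain_def control_curvature_def Let_def)

text \<open>
  Cost of one noise-free step followed by the discounted terminal cost \<open>s\<^sup>T X s\<close>. Noise only adds a
  constant to it, so all minimisations over actions can be carried out here.
\<close>

definition lookahead_cost ::
    "('s::finite, 'a::finite) lqr \<Rightarrow> real^'s^'s \<Rightarrow> real^'s \<Rightarrow> real^'a \<Rightarrow> real" where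
  "lookahead_cost M X s a =
     lqr_cost M s a + lqr_gamma M * quad_form X (lqr_A M *v s + lqr_B M *v a)"

lemma closed_loop_mult:
  "lqr_A M *v s + lqr_B M *v (- (K *v s)) = closed_loop M K *v s"
  by (simp add: closed_loop_def matrix_vector_mult_diff_rdistrib matrix_vector_mul_assoc[symmetric]
      vec.neg)

lemma lqr_cost_quad_form: "lqr_cost M s a = quad_form (lqr_Q M) s + quad_form (lqr_R M) a"
  by (simp add: lqr_cost_def quad_form_def)

lemma lqr_cost_nonneg:
  assumes "lqr_model M"
  shows "0 \<le> lqr_cost M s a"
  using assms unfolding lqr_cost_quad_form lqr_model_def psd_mat_alt pd_mat_alt
  by (metis add_nonneg_nonneg inner_zero_left less_eq_real_def quad_form_def)

lemma lookahead_cost_nonneg: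
  assumes "lqr_model M" "psd_mat X"
  shows "0 \<le> lookahead_cost M X s a"
  using lqr_cost_nonneg[OF assms(1)] assms
  by (auto simp: lookahead_cost_def psd_mat_alt lqr_model_def)

lemma pd_control_curvature:
  assumes "lqr_model M" "psd_mat X"
  shows "pd_mat (control_curvature M X)"
proof -
  have "0 < quad_form (control_curvature M X) x" if "x \<noteq> 0" for x
    unfolding control_curvature_def quad_form_add quad_form_scaleR quad_form_congruence
    using assms that by (intro add_pos_nonneg) (auto simp: lqr_model_def pd_mat_alt psd_mat_alt)
  moreover have "transpose (control_curvature M X) = control_curvature M X"
    using assms
    by (simp add: control_curvature_def transpose_add transpose_scalar transpose_congruence
        lqr_model_def pd_mat_def psd_mat_def)
  ultimately show ?thesis by (simp add: pd_mat_alt)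
qed

text \<open>
  Completing the square in the action: the Riccati operator gives the minimum, the gain the
  minimiser, and the curvature the price of deviating. Nonnegativity and monotonicity of the operator
  are read off from this identity.
\<close>

lemma lookahead_cost_complete_square:
  assumes M: "lqr_model M" and X: "psd_mat X"
  shows "lookahead_cost M X s a = quad_form (riccati_op M X) s
           + quad_form (control_curvature M X) (a + riccati_gain M X *v s)"
proof -
  define A B Q R \<gamma> where "A = lqr_A M" and "B = lqr_B M" and "Q = lqr_Q M" and "R = lqr_R M"
    and "\<gamma> = lqr_gamma M"
  note defs = A_def B_def Q_def R_def \<gamma>_def
  define G where "G = control_curvature M X"
  define k where "k = riccati_gain M X *v s"
  define h where "h = \<gamma> *\<^sub>R (transpose B *v (X *v (A *v s)))"
  have symX: "transpose X = X" using X by (simp add: psd_mat_def)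
  have pd: "pd_mat G" unfolding G_def by (rule pd_control_curvature[OF M X])
  then have symG: "transpose G = G" by (simp add: pd_mat_def)
  have k: "k = matrix_inv G *v h"
    by (simp add: k_def h_def riccati_gain_def G_def defs matrix_vector_mul_assoc[symmetric]
        matrix_vector_mult_scaleR scaleR_matrix_vector_assoc[symmetric] del: transpose_matrix_vector)
  then have Gk: "G *v k = h"
    by (simp add: matrix_vector_mul_assoc matrix_inv_inverse(1)[OF pd_mat_invertible[OF pd]])
  have cross: "\<gamma> * ((B *v u) \<bullet> (X *v (A *v s))) = u \<bullet> h" for u
    unfolding h_def inner_scaleR_right using inner_transpose_mult[of B "X *v (A *v s)" u]
    by (simp add: inner_commute)
  have "s \<bullet> ((transpose A ** X ** B ** matrix_inv G ** transpose B ** X ** A) *v s)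
      = (A *v s) \<bullet> (X *v (B *v (matrix_inv G *v (transpose B *v (X *v (A *v s))))))"
    unfolding matrix_vector_mul_assoc[symmetric]
    by (metis inner_commute inner_transpose_mult)
  also have "\<dots> = (B *v (matrix_inv G *v (transpose B *v (X *v (A *v s))))) \<bullet> (X *v (A *v s))"
    by (rule inner_symmetric_mult[OF symX])
  finally have "\<gamma>\<^sup>2 * quad_form (transpose A ** X ** B ** matrix_inv G ** transpose B ** X ** A) s
      = \<gamma> * ((B *v k) \<bullet> (X *v (A *v s)))"
    by (simp add: quad_form_def k h_def matrix_vector_mult_scaleR power2_eq_square
        del: transpose_matrix_vector)
  also have "\<dots> = k \<bullet> h" by (rule cross)
  finally have ric: "quad_form (riccati_op M X) s
      = quad_form Q s + \<gamma> * quad_form X (A *v s) - k \<bullet> h"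
    by (simp add: riccati_op_def Let_def quad_form_add quad_form_diff quad_form_scaleR
        quad_form_congruence G_def control_curvature_def defs)
  have "quad_form G (a + k) = quad_form G a + 2 * (a \<bullet> h) + k \<bullet> h"
    using inner_symmetric_mult[OF symG, of k a]
    by (simp add: quad_form_plus[OF symG] Gk) (simp add: quad_form_def Gk)
  moreover have "quad_form G a = quad_form R a + \<gamma> * quad_form X (B *v a)"
    by (simp add: G_def control_curvature_def quad_form_add quad_form_scaleR
        quad_form_congruence defs)
  moreover have "\<gamma> * quad_form X (A *v s + B *v a)
      = \<gamma> * quad_form X (A *v s) + 2 * (a \<bullet> h) + \<gamma> * quad_form X (B *v a)"
    by (simp add: quad_form_plus[OF symX] distrib_left cross[symmetric])
  ultimately show ?thesis
    by (simp add: lookahead_cost_def lqr_cost_quad_form ric flip: defs G_def k_def)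
qed

lemma lookahead_cost_riccati_gain:
  assumes "lqr_model M" "psd_mat X"
  shows "lookahead_cost M X s (- (riccati_gain M X *v s)) = quad_form (riccati_op M X) s"
  by (simp add: lookahead_cost_complete_square[OF assms] quad_form_def)

lemma riccati_op_le_lookahead_cost:
  assumes "lqr_model M" "psd_mat X"
  shows "quad_form (riccati_op M X) s \<le> lookahead_cost M X s a"
  using pd_control_curvature[OF assms] unfolding lookahead_cost_complete_square[OF assms] pd_mat_alt
  by (metis add.commute add_0 add_le_cancel_right inner_zero_left less_eq_real_def quad_form_def)

lemma riccati_op_psd:
  assumes M: "lqr_model M" and X: "psd_mat X"
  shows "psd_mat (riccati_op M X)"
proof -
  have pd: "pd_mat (control_curvature M X)" by (rule pd_control_curvature[OF assms])
  have inv: "transpose (matrix_inv (control_curvature M X)) = matrix_inv (control_curvature M X)"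
    using pd pd_mat_invertible[OF pd] by (intro transpose_matrix_inv) (auto simp: pd_mat_def)
  have "transpose X = X" "transpose (lqr_Q M) = lqr_Q M"
    using assms by (auto simp: psd_mat_def lqr_model_def)
  then have "transpose (riccati_op M X) = riccati_op M X"
    unfolding riccati_op_def Let_def control_curvature_def[symmetric]
    by (simp add: transpose_add transpose_diff transpose_scalar matrix_transpose_mul inv
        matrix_mul_assoc)
  moreover have "0 \<le> quad_form (riccati_op M X) s" for s
    unfolding lookahead_cost_riccati_gain[OF assms, symmetric]
    by (rule lookahead_cost_nonneg[OF assms])
  ultimately show ?thesis by (simp add: psd_mat_alt)
qed

text \<open>
  A minimum over actions of functions that increase with \<open>X\<close> increases with \<open>X\<close>.
\<close>

lemma riccati_op_mono:
  assumes M: "lqr_model M" and X: "psd_mat X" and Y: "psd_mat Y"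
    and le: "\<And>x. quad_form X x \<le> quad_form Y x"
  shows "quad_form (riccati_op M X) s \<le> quad_form (riccati_op M Y) s"
proof -
  let ?a = "- (riccati_gain M Y *v s)"
  have "quad_form (riccati_op M X) s \<le> lookahead_cost M X s ?a"
    by (rule riccati_op_le_lookahead_cost[OF M X])
  also have "\<dots> \<le> lookahead_cost M Y s ?a"
    using M le by (simp add: lookahead_cost_def lqr_model_def mult_left_mono)
  also have "\<dots> = quad_form (riccati_op M Y) s"
    by (rule lookahead_cost_riccati_gain[OF M Y])
  finally show ?thesis .
qed

section \<open>Existence and uniqueness of the Riccati solution\<close>

lemma psd_mat_zero: "psd_mat 0"
  by (simp add: psd_mat_alt)

text \<open>
  The forms converge pointwise by monotonicity; polarization turns this into convergence of the entries.
\<close>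

lemma increasing_psd_limit:
  fixes P :: "nat \<Rightarrow> real^'n^'n"
  assumes psd: "\<And>k. psd_mat (P k)"
    and incr: "\<And>k x. quad_form (P k) x \<le> quad_form (P (Suc k)) x"
    and bdd: "\<And>k x. quad_form (P k) x \<le> b x"
  obtains L where "psd_mat L" "P \<longlonglongrightarrow> L" "\<And>k x. quad_form (P k) x \<le> quad_form L x"
proof -
  have sym: "transpose (P k) = P k" for k using psd by (simp add: psd_mat_def)
  have inc: "incseq (\<lambda>k. quad_form (P k) x)" for x using incr by (rule incseq_SucI)
  have "\<exists>l. (\<lambda>k. quad_form (P k) x) \<longlonglongrightarrow> l \<and> (\<forall>k. quad_form (P k) x \<le> l)" for x
  proof -
    have "\<forall>k. quad_form (P k) x \<le> b x" using bdd by blast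
    then obtain l where "(\<lambda>k. quad_form (P k) x) \<longlonglongrightarrow> l" "\<forall>k. quad_form (P k) x \<le> l"
      by (rule incseq_convergent[OF inc])
    then show ?thesis by (intro exI conjI)
  qed
  then have "\<exists>g. \<forall>x. (\<lambda>k. quad_form (P k) x) \<longlonglongrightarrow> g x \<and> (\<forall>k. quad_form (P k) x \<le> g x)"
    by (rule choice[OF allI])
  then obtain g where g: "\<And>x. (\<lambda>k. quad_form (P k) x) \<longlonglongrightarrow> g x"
    and le_g: "\<And>k x. quad_form (P k) x \<le> g x"
    by blast
  define L :: "real^'n^'n" where
    "L = (\<chi> i j. (g (axis i 1 + axis j 1) - g (axis i 1) - g (axis j 1)) / 2)"
  have lim: "P \<longlonglongrightarrow> L"
    unfolding L_def
    by (intro vec_tendstoI) (simp add: symmetric_entry_polarization[OF sym], intro tendsto_intros g, simp)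
  have qlim: "(\<lambda>k. quad_form (P k) x) \<longlonglongrightarrow> quad_form L x" for x
    unfolding quad_form_entries by (intro tendsto_intros lim)
  then have gL: "g x = quad_form L x" for x using g LIMSEQ_unique by blast
  have "0 \<le> quad_form L x" for x
    using psd[of 0] le_g[of 0 x] unfolding gL psd_mat_alt by (metis order.trans)
  moreover have "transpose L = L"
    unfolding L_def transpose_def by (simp add: vec_eq_iff add.commute)
  ultimately have "psd_mat L" by (simp add: psd_mat_alt)
  then show ?thesis using lim le_g unfolding gL by (rule that)
qed

lemma tendsto_quad_form_matrix: "P \<longlonglongrightarrow> L \<Longrightarrow> (\<lambda>k. quad_form (P k) x) \<longlonglongrightarrow> quad_form L x"
  unfolding quad_form_entries by (intro tendsto_intros)

lemma tendsto_quad_form_bounded: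
  fixes X :: "nat \<Rightarrow> real^'n^'n" and y :: "nat \<Rightarrow> real^'n"
  assumes "X \<longlonglongrightarrow> 0" and "\<And>k. norm (y k) \<le> c"
  shows "(\<lambda>k. quad_form (X k) (y k)) \<longlonglongrightarrow> 0"
proof (rule tendsto_rabs_zero_cancel, rule tendsto_sandwich)
  show "\<forall>\<^sub>F k in sequentially. 0 \<le> \<bar>quad_form (X k) (y k)\<bar>" by simp
  show "\<forall>\<^sub>F k in sequentially. \<bar>quad_form (X k) (y k)\<bar> \<le> entry_sum (X k) * c\<^sup>2"
  proof (rule always_eventually, rule allI)
    fix k
    have "y k \<bullet> y k \<le> c\<^sup>2"
      unfolding dot_square_norm using assms(2) by (intro power_mono) auto
    then show "\<bar>quad_form (X k) (y k)\<bar> \<le> entry_sum (X k) * c\<^sup>2"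
      using abs_quad_form_le_entry_sum[of "X k" "y k"]
        mult_left_mono[OF _ entry_sum_nonneg[of "X k"]] by fastforce
  qed
  have "(\<lambda>k. entry_sum (X k)) \<longlonglongrightarrow> (\<Sum>(i::'n)\<in>UNIV. \<Sum>(j::'n)\<in>UNIV. \<bar>(0::real^'n^'n) $ i $ j\<bar>)"
    unfolding entry_sum_def by (intro tendsto_intros assms)
  then have "(\<lambda>k. entry_sum (X k)) \<longlonglongrightarrow> 0" by simp
  then show "(\<lambda>k. entry_sum (X k) * c\<^sup>2) \<longlonglongrightarrow> 0" by (rule tendsto_mult_left_zero)
qed simp

definition riccati_iterate :: "('s::finite, 'a::finite) lqr \<Rightarrow> nat \<Rightarrow> real^'s^'s" where
  "riccati_iterate M k = (riccati_op M ^^ k) 0"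

lemma riccati_iterate_simps [simp]:
  "riccati_iterate M 0 = 0" "riccati_iterate M (Suc k) = riccati_op M (riccati_iterate M k)"
  by (simp_all add: riccati_iterate_def)

lemma riccati_iterate_psd:
  "lqr_model M \<Longrightarrow> psd_mat (riccati_iterate M k)"
  by (induction k) (simp_all add: psd_mat_zero riccati_op_psd)

lemma riccati_iterate_incr:
  assumes M: "lqr_model M"
  shows "quad_form (riccati_iterate M k) x \<le> quad_form (riccati_iterate M (Suc k)) x"
proof (induction k arbitrary: x)
  case 0 then show ?case using riccati_iterate_psd[OF M, of 1] by (simp add: psd_mat_alt)
next
  case (Suc k)
  then show ?case
    using riccati_op_mono[OF M riccati_iterate_psd[OF M] riccati_iterate_psd[OF M], of k "Suc k"]
    by simp
qed

text \<open>
  The limit \<open>L\<close> satisfies \<open>L \<le> riccati_op L\<close> by monotonicity. For the converse the minimising actions of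
  the iterates are tested in the problem for \<open>L\<close>. Since \<open>R\<close> is positive definite and the costs are
  bounded, these actions stay bounded, so replacing the iterate by \<open>L\<close> costs a vanishing amount.
\<close>

lemma riccati_iterates_converge:
  assumes M: "lqr_model M" and bdd: "\<And>k x. quad_form (riccati_iterate M k) x \<le> b x"
  obtains P where "psd_mat P" "P = riccati_op M P" "riccati_iterate M \<longlonglongrightarrow> P"
proof -
  obtain L where L: "psd_mat L" "riccati_iterate M \<longlonglongrightarrow> L"
    and le: "\<And>k x. quad_form (riccati_iterate M k) x \<le> quad_form L x"
    using increasing_psd_limit[where P = "riccati_iterate M" and b = b]
      riccati_iterate_psd[OF M] riccati_iterate_incr[OF M] bdd by metis
  have \<gamma>: "0 < lqr_gamma M" and R: "pd_mat (lqr_R M)" and Q: "psd_mat (lqr_Q M)"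
    using M by (auto simp: lqr_model_def)
  obtain r where r: "0 < r" "\<And>a. r * (a \<bullet> a) \<le> quad_form (lqr_R M) a"
    using pd_mat_lower_bound[OF R] by metis
  have fix_form: "quad_form L s = quad_form (riccati_op M L) s" for s
  proof (rule antisym)
    show "quad_form L s \<le> quad_form (riccati_op M L) s"
    proof (rule LIMSEQ_le_const2[OF tendsto_quad_form_matrix[OF L(2)]], intro exI allI impI)
      fix k :: nat
      show "quad_form (riccati_iterate M k) s \<le> quad_form (riccati_op M L) s"
        using riccati_iterate_incr[OF M, of k s]
          riccati_op_mono[OF M riccati_iterate_psd[OF M] L(1) le, of k s] by simp
    qed
  next
    define a where "a k = - (riccati_gain M (riccati_iterate M k) *v s)" for k
    define y where "y k = lqr_A M *v s + lqr_B M *v a k" for k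
    have step: "quad_form (riccati_iterate M (Suc k)) s = lookahead_cost M (riccati_iterate M k) s (a k)" for k
      unfolding a_def lookahead_cost_riccati_gain[OF M riccati_iterate_psd[OF M]] by simp
    have "norm (a k) \<le> sqrt (quad_form L s / r)" for k
    proof -
      have "r * (a k \<bullet> a k) \<le> quad_form (lqr_R M) (a k)" by (rule r)
      also have "\<dots> \<le> lookahead_cost M (riccati_iterate M k) s (a k)"
        unfolding lookahead_cost_def lqr_cost_quad_form
        using Q riccati_iterate_psd[OF M, of k] \<gamma> by (simp add: psd_mat_alt)
      also have "\<dots> \<le> quad_form L s" unfolding step[symmetric] by (rule le)
      finally have "(norm (a k))\<^sup>2 \<le> quad_form L s / r"
        using r(1) by (simp add: field_simps dot_square_norm)
      then show ?thesis by (rule real_le_rsqrt)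
    qed
    then have "norm (y k) \<le> norm (lqr_A M *v s) + onorm ((*v) (lqr_B M)) * sqrt (quad_form L s / r)" for k
      unfolding y_def
      by (intro norm_triangle_mono order.refl order.trans[OF onorm[OF matrix_vector_mul_bounded_linear]]
          mult_left_mono onorm_pos_le matrix_vector_mul_bounded_linear)
    then have "(\<lambda>k. quad_form (L - riccati_iterate M k) (y k)) \<longlonglongrightarrow> 0"
      using tendsto_diff[OF tendsto_const[of L] L(2)]
      by (intro tendsto_quad_form_bounded) auto
    then have "(\<lambda>k. quad_form (riccati_iterate M (Suc k)) s
        + lqr_gamma M * quad_form (L - riccati_iterate M k) (y k)) \<longlonglongrightarrow> quad_form L s + lqr_gamma M * 0"
      by (intro tendsto_intros LIMSEQ_Suc[OF tendsto_quad_form_matrix[OF L(2)]])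
    moreover have "quad_form (riccati_op M L) s
        \<le> quad_form (riccati_iterate M (Suc k)) s
          + lqr_gamma M * quad_form (L - riccati_iterate M k) (y k)" for k
      using riccati_op_le_lookahead_cost[OF M L(1), of s "a k"]
      unfolding step lookahead_cost_def quad_form_diff y_def by (simp add: algebra_simps)
    ultimately show "quad_form (riccati_op M L) s \<le> quad_form L s"
      using LIMSEQ_le_const[of _ "quad_form L s" "quad_form (riccati_op M L) s"] by simp
  qed
  have "transpose L = L" "transpose (riccati_op M L) = riccati_op M L"
    using L(1) riccati_op_psd[OF M L(1)] by (auto simp only: psd_mat_def)
  then have "L = riccati_op M L" using fix_form by (rule symmetric_eqI)
  with L show ?thesis using that by blast
qed

text \<open>
  Along the discounted closed loop the form of \<open>P\<close> decreases in each step by the stage cost. Hence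
  the stage costs are summable, and both \<open>H x\<^bsub>t\<^esub>\<close>, where \<open>H\<^sup>2 = Q\<close>, and the actions tend to zero. Output
  injection by the detectability gain \<open>J\<close> rewrites the closed loop as a stable recursion whose input
  consists of just these two vanishing terms.
\<close>

lemma riccati_closed_loop_vanishes:
  assumes M: "lqr_model M" and det: "lqr_stab_det M" and P: "psd_mat P" "P = riccati_op M P"
    and x: "\<And>t. x (Suc t) = sqrt (lqr_gamma M) *\<^sub>R (closed_loop M (riccati_gain M P) *v x t)"
  shows "x \<longlonglongrightarrow> 0"
proof -
  define \<gamma> K where "\<gamma> = lqr_gamma M" and "K = riccati_gain M P"
  have \<gamma>: "0 < \<gamma>" and R: "pd_mat (lqr_R M)" using M by (auto simp: lqr_model_def \<gamma>_def)
  obtain H where H: "psd_mat H" "H ** H = lqr_Q M" "detectable (sqrt \<gamma> *\<^sub>R lqr_A M) H"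
    using det by (auto simp: lqr_stab_det_def \<gamma>_def)
  then obtain J where J: "mat_spectral_radius (sqrt \<gamma> *\<^sub>R lqr_A M - J ** H) < 1"
    by (auto simp: detectable_def)
  obtain r where r: "0 < r" "\<And>a. r * (a \<bullet> a) \<le> quad_form (lqr_R M) a"
    using pd_mat_lower_bound[OF R] by metis
  define c where "c t = lqr_cost M (x t) (- (K *v x t))" for t
  have c: "c t = (norm (H *v x t))\<^sup>2 + quad_form (lqr_R M) (K *v x t)" for t
  proof -
    have "quad_form (lqr_Q M) (x t) = (H *v x t) \<bullet> (H *v x t)"
      unfolding H(2)[symmetric] quad_form_def matrix_vector_mul_assoc[symmetric]
      using H(1) inner_symmetric_mult psd_mat_def by blast
    moreover have "quad_form (lqr_R M) (- (K *v x t)) = quad_form (lqr_R M) (K *v x t)"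
      using quad_form_scaled_vector[of _ "-1"] by simp
    ultimately show ?thesis by (simp add: c_def lqr_cost_quad_form dot_square_norm)
  qed
  have decr: "c t = quad_form P (x t) - quad_form P (x (Suc t))" for t
  proof -
    have "quad_form P (x t) = quad_form (riccati_op M P) (x t)" by (simp only: P(2)[symmetric])
    also have "\<dots> = c t + \<gamma> * quad_form P (lqr_A M *v x t + lqr_B M *v (- (K *v x t)))"
      unfolding lookahead_cost_riccati_gain[OF M P(1), symmetric]
      by (simp add: lookahead_cost_def c_def K_def \<gamma>_def)
    also have "lqr_A M *v x t + lqr_B M *v (- (K *v x t)) = closed_loop M K *v x t"
      by (rule closed_loop_mult)
    finally show ?thesis
      using \<gamma> by (simp add: x quad_form_scaled_vector K_def \<gamma>_def)
  qed
  have "(\<Sum>t<n. c t) = quad_form P (x 0) - quad_form P (x n)" for n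
    by (induction n) (simp_all add: decr)
  then have "(\<Sum>t<n. c t) \<le> quad_form P (x 0)" for n
    using P(1) by (simp add: psd_mat_alt)
  moreover have c0: "0 \<le> c t" for t unfolding c_def by (rule lqr_cost_nonneg[OF M])
  ultimately have "summable c" by (intro summableI_nonneg_bounded)
  then have lim: "c \<longlonglongrightarrow> 0" by (rule summable_LIMSEQ_zero)
  have Rnn: "r * (norm (K *v x t))\<^sup>2 \<le> quad_form (lqr_R M) (K *v x t)" for t
    using r(2)[of "K *v x t"] by (simp add: dot_square_norm)
  have "(\<lambda>t. (norm (H *v x t))\<^sup>2) \<longlonglongrightarrow> 0"
  proof (rule tendsto_sandwich[OF _ _ tendsto_const lim]; rule always_eventually, rule allI)
    fix t show "(norm (H *v x t))\<^sup>2 \<le> c t"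
      using Rnn[of t] r(1) unfolding c by (smt (verit) mult_nonneg_nonneg zero_le_power2)
  qed simp
  then have Hx: "(\<lambda>t. H *v x t) \<longlonglongrightarrow> 0"
    by (simp add: tendsto_norm_zero_iff)
  have "(\<lambda>t. r * (norm (K *v x t))\<^sup>2) \<longlonglongrightarrow> 0"
  proof (rule tendsto_sandwich[OF _ _ tendsto_const lim]; rule always_eventually, rule allI)
    fix t show "r * (norm (K *v x t))\<^sup>2 \<le> c t"
      using Rnn[of t] unfolding c by (smt (verit) zero_le_power2)
  qed (use r(1) in simp)
  then have Kx: "(\<lambda>t. K *v x t) \<longlonglongrightarrow> 0"
    using r(1) by (simp add: tendsto_norm_zero_iff tendsto_mult_left_iff)
  define u where "u t = J *v (H *v x t) - sqrt \<gamma> *\<^sub>R (lqr_B M *v (K *v x t))" for t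
  show ?thesis
  proof (rule stable_forced_recursion_tendsto_zero[OF J])
    show "x (Suc t) = (sqrt \<gamma> *\<^sub>R lqr_A M - J ** H) *v x t + u t" for t
      by (simp add: x u_def closed_loop_def matrix_vector_mult_diff_rdistrib K_def \<gamma>_def
          matrix_vector_mul_assoc[symmetric] scaleR_matrix_vector_assoc[symmetric] scaleR_right_diff_distrib)
    have "u \<longlonglongrightarrow> J *v 0 - sqrt \<gamma> *\<^sub>R (lqr_B M *v 0)"
      unfolding u_def by (intro tendsto_intros tendsto_matrix_vector_mult Hx Kx)
    then show "u \<longlonglongrightarrow> 0" by simp
  qed
qed

text \<open>
  Under the gain of \<open>P\<close>, the form of \<open>Y - P\<close> does not decrease along the closed loop, since that gain
  is optimal for \<open>P\<close> and merely admissible for \<open>Y\<close>. As the closed loop tends to zero, the form is at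
  most zero at the start.
\<close>

lemma riccati_fixpoint_le:
  assumes M: "lqr_model M" and det: "lqr_stab_det M"
    and P: "psd_mat P" "P = riccati_op M P" and Y: "psd_mat Y" "Y = riccati_op M Y"
  shows "quad_form Y s \<le> quad_form P s"
proof -
  define K where "K = riccati_gain M P"
  define x where "x t = ((\<lambda>z. sqrt (lqr_gamma M) *\<^sub>R (closed_loop M K *v z)) ^^ t) s" for t
  have xS: "x (Suc t) = sqrt (lqr_gamma M) *\<^sub>R (closed_loop M K *v x t)" for t by (simp add: x_def)
  have \<gamma>: "0 < lqr_gamma M" using M by (simp add: lqr_model_def)
  have x0: "x \<longlonglongrightarrow> 0"
    by (rule riccati_closed_loop_vanishes[where x = x, OF M det P xS[unfolded K_def]])
  have look: "lookahead_cost M X (x t) (- (K *v x t))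
      = lqr_cost M (x t) (- (K *v x t)) + quad_form X (x (Suc t))" for X t
    using \<gamma> by (simp add: lookahead_cost_def closed_loop_mult xS quad_form_scaled_vector
        del: add_uminus_conv_diff)
  have step: "quad_form (Y - P) (x t) \<le> quad_form (Y - P) (x (Suc t))" for t
  proof -
    have "quad_form Y (x t) \<le> lookahead_cost M Y (x t) (- (K *v x t))"
      using riccati_op_le_lookahead_cost[OF M Y(1)] Y(2) by metis
    moreover have "quad_form P (x t) = lookahead_cost M P (x t) (- (K *v x t))"
      using lookahead_cost_riccati_gain[OF M P(1)] P(2) unfolding K_def by metis
    ultimately show ?thesis by (simp add: look quad_form_diff)
  qed
  have "quad_form (Y - P) s \<le> quad_form (Y - P) (x t)" for t
    by (induction t) (use step in \<open>auto simp: x_def intro: order.trans\<close>)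
  moreover have "(\<lambda>t. quad_form (Y - P) (x t)) \<longlonglongrightarrow> 0"
    using tendsto_inner[OF x0 tendsto_matrix_vector_mult[OF x0, of "Y - P"]] by (simp add: quad_form_def)
  ultimately have "quad_form (Y - P) s \<le> 0" by (intro LIMSEQ_le_const) auto
  then show ?thesis by (simp add: quad_form_diff)
qed

lemma riccati_sol_eqI:
  assumes M: "lqr_model M" and det: "lqr_stab_det M" and P: "psd_mat P" "P = riccati_op M P"
  shows "riccati_sol M = P"
  unfolding riccati_sol_def
proof (rule the_equality)
  fix Y assume Y: "psd_mat Y \<and> Y = riccati_op M Y"
  then have Y: "psd_mat Y" "Y = riccati_op M Y" by auto
  have eq: "quad_form Y x = quad_form P x" for x
    by (intro antisym riccati_fixpoint_le[OF M det P Y] riccati_fixpoint_le[OF M det Y P])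
  have "transpose Y = Y" "transpose P = P"
    using Y(1) P(1) by (simp_all only: psd_mat_def)
  then show "Y = P" using eq by (rule symmetric_eqI)
qed (use P in blast)

section \<open>Quadratic functions under the Bellman operators\<close>

lemma trace_mult_symmetric:
  fixes S X :: "real^'n^'n"
  assumes "transpose X = X"
  shows "trace (S ** X) = (\<Sum>i\<in>UNIV. \<Sum>j\<in>UNIV. X $ i $ j * S $ i $ j)"
proof -
  have "X $ j $ i = X $ i $ j" for i j using assms by (metis transpose_def vec_lambda_beta)
  then show ?thesis by (simp add: trace_def matrix_matrix_mult_def mult.commute)
qed

lemma tendsto_trace_mult: "P \<longlonglongrightarrow> L \<Longrightarrow> (\<lambda>k. trace (S ** P k)) \<longlonglongrightarrow> trace (S ** L)"
  for S L :: "real^'n^'n"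
  unfolding trace_def matrix_matrix_mult_def
  by (simp add: tendsto_sum tendsto_mult tendsto_vec_nth)

lemma trace_mult_add: "trace (S ** (X + Y)) = trace (S ** X) + trace (S ** Y)"
  for S :: "real^'n^'n"
  by (simp add: matrix_add_ldistrib trace_add)

lemma trace_mult_scaleR_mat1: "trace (S ** (c *\<^sub>R mat 1)) = c * trace S"
  for S :: "real^'n^'n"
  by (simp add: trace_def matrix_matrix_mult_def mat_def sum_distrib_left if_distrib mult.commute
      cong: if_cong)

text \<open>
  The cross term vanishes because the noise has mean zero; the quadratic term contributes the trace.
\<close>

lemma has_bochner_integral_noise_quad_form:
  assumes M: "lqr_model M" and X: "transpose X = X"
  shows "has_bochner_integral (lqr_noise M) (\<lambda>\<xi>. quad_form X (y + \<xi>) + c)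
           (quad_form X y + trace (lqr_Sigma M ** X) + c)"
proof -
  interpret prob_space "lqr_noise M" using M by (simp add: lqr_model_def)
  have mean: "has_bochner_integral (lqr_noise M) (\<lambda>\<xi>. \<xi>) 0"
    and cov: "has_bochner_integral (lqr_noise M) (\<lambda>\<xi>. \<xi> $ i * \<xi> $ j) (lqr_Sigma M $ i $ j)" for i j
    using M by (auto simp: lqr_model_def)
  have const: "has_bochner_integral (lqr_noise M) (\<lambda>\<xi>. r) r" for r :: real
    by (simp add: has_bochner_integral_iff prob_space)
  have "has_bochner_integral (lqr_noise M) (\<lambda>\<xi>. \<xi> \<bullet> (X *v y)) (0 \<bullet> (X *v y))"
    by (rule has_bochner_integral_inner_left) (rule mean)
  then have lin: "has_bochner_integral (lqr_noise M) (\<lambda>\<xi>. 2 * (\<xi> \<bullet> (X *v y))) (2 * 0)"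
    by (intro has_bochner_integral_mult_right) simp
  have quad: "has_bochner_integral (lqr_noise M) (\<lambda>\<xi>. quad_form X \<xi>) (trace (lqr_Sigma M ** X))"
    unfolding quad_form_entries trace_mult_symmetric[OF X]
    by (intro has_bochner_integral_sum has_bochner_integral_mult_right cov)
  have "has_bochner_integral (lqr_noise M)
      (\<lambda>\<xi>. quad_form X y + 2 * (\<xi> \<bullet> (X *v y)) + quad_form X \<xi> + c)
      (quad_form X y + 2 * 0 + trace (lqr_Sigma M ** X) + c)"
    by (intro has_bochner_integral_add const lin quad)
  then show ?thesis by (simp add: quad_form_plus[OF X])
qed

lemma nn_integral_noise_quad_form:
  assumes M: "lqr_model M" and X: "psd_mat X" and c: "0 \<le> c"
  shows "(\<integral>\<^sup>+\<xi>. ennreal (quad_form X (y + \<xi>) + c) \<partial>lqr_noise M)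
           = ennreal (quad_form X y + trace (lqr_Sigma M ** X) + c)"
proof -
  have "transpose X = X" using X by (simp add: psd_mat_def)
  note h = has_bochner_integral_noise_quad_form[OF M this, of y c]
  have nn: "0 \<le> quad_form X (y + \<xi>) + c" for \<xi> using X c by (simp add: psd_mat_alt)
  show ?thesis
    using nn_integral_eq_integral[OF integrable.intros[OF h]] nn
    by (simp add: has_bochner_integral_integral_eq[OF h])
qed

lemma trace_Sigma_nonneg:
  assumes M: "lqr_model M" and X: "psd_mat X"
  shows "0 \<le> trace (lqr_Sigma M ** X)"
proof -
  have "transpose X = X" using X by (simp add: psd_mat_def)
  note h = has_bochner_integral_noise_quad_form[OF M this, of 0 0]
  have "0 \<le> (\<integral>\<xi>. quad_form X (0 + \<xi>) + 0 \<partial>lqr_noise M)"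
    using X by (intro integral_nonneg_AE) (simp add: psd_mat_alt)
  also have "\<dots> = quad_form X 0 + trace (lqr_Sigma M ** X) + 0"
    by (rule has_bochner_integral_integral_eq[OF h])
  finally show ?thesis by (simp add: quad_form_def)
qed

lemma quad_weight_quad_form: "quad_weight l s = quad_form (l *\<^sub>R mat 1) s + 1"
  by (simp add: quad_weight_def quad_form_scaleR quad_form_mat1)

lemma quad_weight_ge_1: "0 < l \<Longrightarrow> 1 \<le> quad_weight l s"
  by (simp add: quad_weight_def)

lemma transpose_scaled_mat1 [simp]: "transpose (c *\<^sub>R mat 1 :: real^'n^'n) = c *\<^sub>R mat 1"
  by (simp add: transpose_scalar)

lemma psd_scaled_mat1: "0 \<le> c \<Longrightarrow> psd_mat (c *\<^sub>R mat 1)"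
  by (simp add: psd_mat_alt quad_form_scaleR quad_form_mat1)

lemma psd_mat_add: "psd_mat X \<Longrightarrow> psd_mat Y \<Longrightarrow> psd_mat (X + Y)"
  by (simp add: psd_mat_alt quad_form_add transpose_add)

lemma expected_weight_le:
  fixes A :: "real^'s^'s"
  assumes "0 < l" "1 + l * trace S \<le> \<kappa>" "(A *v s) \<bullet> (A *v s) \<le> \<kappa> * (s \<bullet> s)"
  shows "quad_weight l (A *v s) + l * trace S \<le> \<kappa> * quad_weight l s"
proof -
  have "l * ((A *v s) \<bullet> (A *v s)) \<le> l * (\<kappa> * (s \<bullet> s))"
    using assms by (intro mult_left_mono) auto
  then show ?thesis using assms(2) by (simp add: quad_weight_def algebra_simps)
qed

text \<open>
  The contraction estimate: a weighted bound \<open>N\<close> on a quadratic function becomes \<open>\<kappa> N\<close> after one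
  noisy step.
\<close>

lemma expected_quad_form_contraction:
  fixes X :: "real^'s^'s" and A :: "real^'s^'s" and M :: "('s::finite, 'a::finite) lqr"
  assumes M: "lqr_model M" and X: "transpose X = X" and l: "0 < l"
    and S: "1 + l * trace (lqr_Sigma M) \<le> \<kappa>" and A: "(A *v s) \<bullet> (A *v s) \<le> \<kappa> * (s \<bullet> s)"
    and N: "0 \<le> N" and bound: "\<And>z. \<bar>quad_form X z + c\<bar> \<le> N * quad_weight l z"
  shows "\<bar>quad_form X (A *v s) + trace (lqr_Sigma M ** X) + c\<bar> \<le> N * (\<kappa> * quad_weight l s)"
proof -
  define y where "y = A *v s"
  note h = has_bochner_integral_noise_quad_form[OF M X, of y c]
  note hw = has_bochner_integral_noise_quad_form[OF M transpose_scaled_mat1[of l], of y 1]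
  have "\<bar>quad_form X y + trace (lqr_Sigma M ** X) + c\<bar>
      = \<bar>\<integral>\<xi>. quad_form X (y + \<xi>) + c \<partial>lqr_noise M\<bar>"
    by (simp add: has_bochner_integral_integral_eq[OF h])
  also have "\<dots> \<le> (\<integral>\<xi>. \<bar>quad_form X (y + \<xi>) + c\<bar> \<partial>lqr_noise M)"
    by (rule integral_abs_bound)
  also have "\<dots> \<le> (\<integral>\<xi>. N * (quad_form (l *\<^sub>R mat 1) (y + \<xi>) + 1) \<partial>lqr_noise M)"
    using integrable.intros[OF h] integrable.intros[OF hw] bound
    by (intro integral_mono) (auto simp: quad_weight_quad_form)
  also have "\<dots> = N * (\<integral>\<xi>. quad_form (l *\<^sub>R mat 1) (y + \<xi>) + 1 \<partial>lqr_noise M)"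
    by (rule integral_mult_right_zero)
  also have "\<dots> = N * (quad_weight l y + l * trace (lqr_Sigma M))"
    unfolding has_bochner_integral_integral_eq[OF hw]
    by (simp add: trace_mult_scaleR_mat1 quad_weight_quad_form)
  also have "\<dots> \<le> N * (\<kappa> * quad_weight l s)"
    unfolding y_def by (intro mult_left_mono expected_weight_le assms)
  finally show ?thesis by (simp add: y_def)
qed

lemma q_value_quad_form:
  assumes M: "lqr_model M" and X: "psd_mat X" and c: "0 \<le> c"
  shows "q_value M (\<lambda>s. ennreal (quad_form X s + c)) s a
           = ennreal (lookahead_cost M X s a + lqr_gamma M * (trace (lqr_Sigma M ** X) + c))"
proof -
  have \<gamma>: "0 < lqr_gamma M" using M by (simp add: lqr_model_def)
  show ?thesis
    unfolding q_value_def lqr_next_def nn_integral_noise_quad_form[OF M X c]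
    using \<gamma> X c lqr_cost_nonneg[OF M] trace_Sigma_nonneg[OF M X]
    by (simp add: ennreal_mult[symmetric] ennreal_plus[symmetric] psd_mat_alt lookahead_cost_def
        distrib_left del: ennreal_plus)
qed

lemma q_value_mono: "(\<And>s. v s \<le> v' s) \<Longrightarrow> q_value M v s a \<le> q_value M v' s a"
  unfolding q_value_def by (intro add_left_mono mult_left_mono nn_integral_mono) auto

lemma bellman_opt_mono: "(\<And>s. v s \<le> v' s) \<Longrightarrow> bellman_opt M v s \<le> bellman_opt M v' s"
  unfolding bellman_opt_def by (rule INF_mono) (use q_value_mono in blast)

lemma bellman_opt_quad_form:
  assumes M: "lqr_model M" and X: "psd_mat X" and c: "0 \<le> c"
  shows "bellman_opt M (\<lambda>s. ennreal (quad_form X s + c)) s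
     = ennreal (quad_form (riccati_op M X) s + lqr_gamma M * (trace (lqr_Sigma M ** X) + c))"
  unfolding bellman_opt_def q_value_quad_form[OF assms]
proof (rule antisym)
  show "(INF a. ennreal (lookahead_cost M X s a + lqr_gamma M * (trace (lqr_Sigma M ** X) + c)))
    \<le> ennreal (quad_form (riccati_op M X) s + lqr_gamma M * (trace (lqr_Sigma M ** X) + c))"
    by (rule INF_lower2[of "- (riccati_gain M X *v s)"])
       (simp_all add: lookahead_cost_riccati_gain[OF M X])
  show "ennreal (quad_form (riccati_op M X) s + lqr_gamma M * (trace (lqr_Sigma M ** X) + c))
    \<le> (INF a. ennreal (lookahead_cost M X s a + lqr_gamma M * (trace (lqr_Sigma M ** X) + c)))"
    by (intro INF_greatest ennreal_leI add_right_mono riccati_op_le_lookahead_cost M X)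
qed

lemma bellman_linear_policy_quad_form:
  assumes M: "lqr_model M" and X: "psd_mat X" and c: "0 \<le> c"
  shows "bellman_policy M (linear_policy K) (\<lambda>s. ennreal (quad_form X s + c)) s
     = ennreal (lookahead_cost M X s (- (K *v s)) + lqr_gamma M * (trace (lqr_Sigma M ** X) + c))"
proof -
  have "continuous_on UNIV (\<lambda>a. lookahead_cost M X s a)"
    unfolding lookahead_cost_def lqr_cost_quad_form quad_form_def
    by (intro continuous_intros bounded_linear.continuous_on[OF matrix_vector_mul_bounded_linear])
  then have "(\<lambda>a. lookahead_cost M X s a) \<in> borel_measurable borel"
    by (rule borel_measurable_continuous_onI)
  then have "(\<lambda>a. ennreal (lookahead_cost M X s a + lqr_gamma M * (trace (lqr_Sigma M ** X) + c)))
      \<in> borel_measurable borel"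
    by measurable
  then show ?thesis
    unfolding bellman_policy_def q_value_quad_form[OF assms] linear_policy_def
    by (subst nn_integral_return) auto
qed

text \<open>
  By the completed square an action attains the minimum only if it equals the one given by the
  Riccati gain, and a gain is determined by its values at all states.
\<close>

lemma greedy_gain_eqI:
  fixes M M' :: "('s::finite, 'a::finite) lqr"
  assumes M: "lqr_model M" and P: "psd_mat P" and q: "0 \<le> q"
    and V: "optimal_value M' = (\<lambda>s. ennreal (quad_form P s + q))"
  shows "greedy_gain M M' = riccati_gain M P"
  unfolding greedy_gain_def V
proof (rule the_equality)
  show "bellman_policy M (linear_policy (riccati_gain M P)) (\<lambda>s. ennreal (quad_form P s + q))
      = bellman_opt M (\<lambda>s. ennreal (quad_form P s + q))"
    by (intro ext) (simp add: bellman_linear_policy_quad_form[OF M P q] bellman_opt_quad_form[OF M P q]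
        lookahead_cost_riccati_gain[OF M P])
next
  fix K :: "real^'s^'a"
  assume eq: "bellman_policy M (linear_policy K) (\<lambda>s. ennreal (quad_form P s + q))
      = bellman_opt M (\<lambda>s. ennreal (quad_form P s + q))"
  have "K *v s = riccati_gain M P *v s" for s
  proof -
    have "0 \<le> lookahead_cost M P s a" for a by (rule lookahead_cost_nonneg[OF M P])
    moreover have "0 \<le> quad_form (riccati_op M P) s"
      using riccati_op_psd[OF M P] by (simp add: psd_mat_alt)
    moreover have "0 \<le> lqr_gamma M * (trace (lqr_Sigma M ** P) + q)"
      using trace_Sigma_nonneg[OF M P] q M by (simp add: lqr_model_def)
    ultimately have "lookahead_cost M P s (- (K *v s)) = quad_form (riccati_op M P) s"
      using fun_cong[OF eq, of s]
      unfolding bellman_linear_policy_quad_form[OF M P q] bellman_opt_quad_form[OF M P q]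
      by (subst (asm) ennreal_inj) auto
    then have "quad_form (control_curvature M P) (riccati_gain M P *v s - K *v s) = 0"
      unfolding lookahead_cost_complete_square[OF M P] by (simp add: add.commute)
    then have "riccati_gain M P *v s - K *v s = 0"
      using pd_control_curvature[OF M P] by (metis less_irrefl pd_mat_alt)
    then show ?thesis by simp
  qed
  then show "K = riccati_gain M P" by (simp add: matrix_eq)
qed

section \<open>The optimal value function\<close>

lemma weighted_funs_bound:
  assumes "V \<in> weighted_funs (quad_weight l)" and l: "0 < l"
  obtains C where "0 \<le> C" "\<And>s. V s \<le> ennreal (C * quad_weight l s)"
proof -
  define w where "w = wnorm (quad_weight l) (\<lambda>s. enn2ereal (V s))"
  have le: "enn2ereal (V s) / ereal (quad_weight l s) \<le> w" for s
    unfolding w_def wnorm_def by (rule SUP_upper2[of s]) (auto simp: enn2ereal_nonneg)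
  have pos: "0 < quad_weight l s" for s using quad_weight_ge_1[OF l, of s] by simp
  have "0 \<le> w"
    using le[of 0] pos[of 0] by (meson enn2ereal_nonneg ereal_less(2) order.strict_implies_order order.trans
      zero_le_divide_ereal)
  moreover have "w < \<infinity>" using assms(1) by (simp add: weighted_funs_def w_def)
  ultimately obtain C where C: "w = ereal C" "0 \<le> C" by (cases w) auto
  have "V s \<le> ennreal (C * quad_weight l s)" for s
  proof -
    have "enn2ereal (V s) \<le> ereal (quad_weight l s) * ereal C"
      using le[of s] pos[of s] unfolding C(1)[symmetric] by (subst (asm) ereal_divide_le_pos) auto
    then show ?thesis
      using C(2) pos[of s] by (simp add: less_eq_ennreal.rep_eq enn2ereal_ennreal mult.commute)
  qed
  with C(2) show ?thesis by (rule that)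
qed

text \<open>
  The fixed point \<open>V\<close> is at most its own one-step lookahead under the gain of \<open>P\<close>. Iterating from
  \<open>V \<le> C w\<close> leaves the quadratic function plus the remainder \<open>C (\<gamma> \<kappa>)\<^sup>n w\<close>, which vanishes. The
  remainder is itself quadratic, so it can be absorbed into the matrix and the constant.
\<close>

lemma fixpoint_le_quadratic:
  fixes M :: "('s::finite, 'a::finite) lqr"
  assumes M: "lqr_model M" and l: "0 < l"
    and P: "psd_mat P" "P = riccati_op M P"
    and q: "0 \<le> q" "q = lqr_gamma M * (trace (lqr_Sigma M ** P) + q)"
    and V: "\<And>s. V s = bellman_opt M V s" and C: "0 \<le> C" "\<And>s. V s \<le> ennreal (C * quad_weight l s)"
    and S: "1 + l * trace (lqr_Sigma M) \<le> \<kappa>"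
    and A: "\<And>s. (closed_loop M (riccati_gain M P) *v s) \<bullet> (closed_loop M (riccati_gain M P) *v s)
              \<le> \<kappa> * (s \<bullet> s)"
    and \<kappa>: "0 \<le> \<kappa>" "lqr_gamma M * \<kappa> < 1"
  shows "V s \<le> ennreal (quad_form P s + q)"
proof -
  define \<gamma> K \<beta> where "\<gamma> = lqr_gamma M" and "K = riccati_gain M P" and "\<beta> = lqr_gamma M * \<kappa>"
  have \<gamma>: "0 < \<gamma>" using M by (simp add: lqr_model_def \<gamma>_def)
  have \<beta>: "0 \<le> \<beta>" "\<beta> < 1" using \<kappa> \<gamma> by (auto simp: \<beta>_def \<gamma>_def)
  have bound: "V s \<le> ennreal (quad_form P s + q + C * \<beta> ^ n * quad_weight l s)" for n s
  proof (induction n arbitrary: s)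
    case 0
    have "C * quad_weight l s \<le> quad_form P s + q + C * \<beta> ^ 0 * quad_weight l s"
      using P(1) q(1) by (simp add: psd_mat_alt)
    then show ?case using C(2)[of s] by (meson ennreal_leI order.trans)
  next
    case (Suc n)
    define d where "d = C * \<beta> ^ n"
    have d: "0 \<le> d" using C(1) \<beta> by (simp add: d_def)
    define X where "X = P + (d * l) *\<^sub>R mat 1"
    have X: "psd_mat X"
      unfolding X_def using d l P(1) by (intro psd_mat_add psd_scaled_mat1) auto
    have le: "V s \<le> ennreal (quad_form X s + (q + d))" for s
      using Suc[of s] by (simp add: X_def d_def quad_form_add quad_form_scaleR quad_form_mat1
          quad_weight_def algebra_simps)
    have "V s \<le> q_value M V s (- (K *v s))"
      unfolding V[of s] bellman_opt_def by (rule INF_lower) simp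
    also have "\<dots> \<le> q_value M (\<lambda>s. ennreal (quad_form X s + (q + d))) s (- (K *v s))"
      using le by (rule q_value_mono)
    also have "\<dots> = ennreal (lookahead_cost M X s (- (K *v s))
        + \<gamma> * (trace (lqr_Sigma M ** X) + (q + d)))"
      using q_value_quad_form[OF M X] q(1) d by (simp add: \<gamma>_def)
    also have "\<dots> \<le> ennreal (quad_form P s + q + C * \<beta> ^ Suc n * quad_weight l s)"
    proof (rule ennreal_leI)
      have "lookahead_cost M P s (- (K *v s)) = quad_form P s"
        unfolding K_def lookahead_cost_riccati_gain[OF M P(1)] using P(2) by metis
      then have "lookahead_cost M X s (- (K *v s))
          = quad_form P s + \<gamma> * (d * (l * ((closed_loop M K *v s) \<bullet> (closed_loop M K *v s))))"
        unfolding lookahead_cost_def X_def closed_loop_mult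
        by (simp add: quad_form_add quad_form_scaleR quad_form_mat1 \<gamma>_def algebra_simps)
      moreover have "trace (lqr_Sigma M ** X) = trace (lqr_Sigma M ** P) + d * l * trace (lqr_Sigma M)"
        by (simp add: X_def trace_mult_add trace_mult_scaleR_mat1)
      ultimately have "lookahead_cost M X s (- (K *v s)) + \<gamma> * (trace (lqr_Sigma M ** X) + (q + d))
          = quad_form P s + \<gamma> * (trace (lqr_Sigma M ** P) + q)
            + \<gamma> * d * (quad_weight l (closed_loop M K *v s) + l * trace (lqr_Sigma M))"
        by (simp add: quad_weight_def algebra_simps)
      also have "\<gamma> * (trace (lqr_Sigma M ** P) + q) = q" using q(2) by (simp add: \<gamma>_def)
      also have "\<gamma> * d * (quad_weight l (closed_loop M K *v s) + l * trace (lqr_Sigma M))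
          \<le> \<gamma> * d * (\<kappa> * quad_weight l s)"
        using \<gamma> d l S A by (intro mult_left_mono expected_weight_le) (auto simp: K_def)
      finally show "lookahead_cost M X s (- (K *v s)) + \<gamma> * (trace (lqr_Sigma M ** X) + (q + d))
          \<le> quad_form P s + q + C * \<beta> ^ Suc n * quad_weight l s"
        by (simp add: d_def \<beta>_def \<gamma>_def mult_ac)
    qed
    finally show ?case .
  qed
  have "(\<lambda>n. ennreal (quad_form P s + q + C * \<beta> ^ n * quad_weight l s))
      \<longlonglongrightarrow> ennreal (quad_form P s + q + C * 0 * quad_weight l s)"
    using \<beta> by (intro tendsto_ennrealI tendsto_intros LIMSEQ_realpow_zero) auto
  then show ?thesis
    using bound LIMSEQ_le_const[of _ "ennreal (quad_form P s + q)" "V s"] by simp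
qed

text \<open>
  Together with the Riccati iterates these constants describe value iteration started at \<open>0\<close>.
\<close>

primrec iterate_offset :: "('s::finite, 'a::finite) lqr \<Rightarrow> nat \<Rightarrow> real" where
  "iterate_offset M 0 = 0"
| "iterate_offset M (Suc k) =
     lqr_gamma M * (trace (lqr_Sigma M ** riccati_iterate M k) + iterate_offset M k)"

lemma iterate_offset_nonneg: "lqr_model M \<Longrightarrow> 0 \<le> iterate_offset M k"
  by (induction k) (auto simp: trace_Sigma_nonneg riccati_iterate_psd lqr_model_def)

lemma iterates_le_fixpoint:
  assumes M: "lqr_model M" and V: "\<And>s. V s = bellman_opt M V s"
  shows "ennreal (quad_form (riccati_iterate M k) s + iterate_offset M k) \<le> V s"
proof (induction k arbitrary: s)
  case (Suc k)
  have "bellman_opt M (\<lambda>s. ennreal (quad_form (riccati_iterate M k) s + iterate_offset M k)) s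
      \<le> bellman_opt M V s"
    by (rule bellman_opt_mono) (rule Suc)
  then show ?case
    unfolding bellman_opt_quad_form[OF M riccati_iterate_psd[OF M] iterate_offset_nonneg[OF M]]
    by (simp flip: V)
qed simp

lemma iterate_offset_tendsto:
  assumes M: "lqr_model M" and lim: "riccati_iterate M \<longlonglongrightarrow> P"
    and q: "q = lqr_gamma M * (trace (lqr_Sigma M ** P) + q)"
  shows "iterate_offset M \<longlonglongrightarrow> q"
proof -
  define b where "b k = \<bar>lqr_gamma M * (trace (lqr_Sigma M ** riccati_iterate M k) - trace (lqr_Sigma M ** P))\<bar>" for k
  have \<gamma>: "0 < lqr_gamma M" "lqr_gamma M < 1" using M by (auto simp: lqr_model_def)
  have "b \<longlonglongrightarrow> \<bar>lqr_gamma M * (trace (lqr_Sigma M ** P) - trace (lqr_Sigma M ** P))\<bar>"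
    unfolding b_def by (intro tendsto_intros tendsto_trace_mult lim)
  then have b: "b \<longlonglongrightarrow> 0" by simp
  have "\<bar>iterate_offset M (Suc k) - q\<bar> \<le> lqr_gamma M * \<bar>iterate_offset M k - q\<bar> + b k" for k
  proof -
    have "iterate_offset M (Suc k) - q = lqr_gamma M * (iterate_offset M k - q)
        + lqr_gamma M * (trace (lqr_Sigma M ** riccati_iterate M k) - trace (lqr_Sigma M ** P))"
      by (subst (1) q) (simp add: algebra_simps)
    then show ?thesis
      unfolding b_def using \<gamma> abs_triangle_ineq by (metis abs_mult abs_of_pos)
  qed
  then have "(\<lambda>k. \<bar>iterate_offset M k - q\<bar>) \<longlonglongrightarrow> 0"
    by (rule linear_recursion_tendsto_zero) (use \<gamma> b in auto)
  then show ?thesis by (simp add: tendsto_rabs_zero_iff LIM_zero_iff)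
qed

definition optimal_offset :: "('s::finite, 'a::finite) lqr \<Rightarrow> real" where
  "optimal_offset M = lqr_gamma M * trace (lqr_Sigma M ** riccati_sol M) / (1 - lqr_gamma M)"

text \<open>
  DP-solvability provides a fixed point of the optimal Bellman operator that equals the optimal value and
  is finite. Value iteration stays below it; this bounds the Riccati iterates, hence provides the Riccati
  solution, and gives the lower bound for the value. The upper bound is
  \<open>fixpoint_le_quadratic\<close>.
\<close>

theorem optimal_value_quadratic:
  fixes M :: "('s::finite, 'a::finite) lqr"
  assumes M: "lqr_model M" and sd: "lqr_stab_det M" and l: "0 < l"
    and dp: "dp_solvable M (quad_weight l)"
    and S: "1 + l * trace (lqr_Sigma M) \<le> \<kappa>"
    and A: "\<And>s. (closed_loop M (opt_gain M) *v s) \<bullet> (closed_loop M (opt_gain M) *v s)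
              \<le> \<kappa> * (s \<bullet> s)"
    and \<kappa>: "0 \<le> \<kappa>" "lqr_gamma M * \<kappa> < 1"
  shows "psd_mat (riccati_sol M)" "riccati_sol M = riccati_op M (riccati_sol M)"
    "0 \<le> optimal_offset M"
    "optimal_offset M = lqr_gamma M * (trace (lqr_Sigma M ** riccati_sol M) + optimal_offset M)"
    "optimal_value M = (\<lambda>s. ennreal (quad_form (riccati_sol M) s + optimal_offset M))"
proof -
  obtain V where V: "V \<in> weighted_funs (quad_weight l)" "V = bellman_opt M V"
    and le: "\<And>\<pi> s. \<pi> \<in> policies \<Longrightarrow> V s \<le> policy_value M \<pi> s"
    and att: "\<exists>\<pi>\<in>policies. \<forall>s. V s = policy_value M \<pi> s"
    using dp unfolding dp_solvable_def by blast
  have opt: "optimal_value M s = V s" for s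
    unfolding optimal_value_def using le att by (intro antisym INF_greatest) (auto intro: INF_lower2)
  have Vs: "V s = bellman_opt M V s" for s using fun_cong[OF V(2)] .
  obtain C where C: "0 \<le> C" "\<And>s. V s \<le> ennreal (C * quad_weight l s)"
    using weighted_funs_bound[OF V(1) l] by metis
  have "quad_form (riccati_iterate M k) s \<le> C * quad_weight l s" for k s
  proof -
    have "ennreal (quad_form (riccati_iterate M k) s + iterate_offset M k) \<le> ennreal (C * quad_weight l s)"
      using iterates_le_fixpoint[OF M Vs] C(2) order.trans by blast
    moreover have "0 \<le> C * quad_weight l s" using C(1) quad_weight_ge_1[OF l, of s] by simp
    ultimately have "quad_form (riccati_iterate M k) s + iterate_offset M k \<le> C * quad_weight l s"
      by (simp add: ennreal_le_iff)
    then show ?thesis using iterate_offset_nonneg[OF M, of k] by simp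
  qed
  then obtain P where P: "psd_mat P" "P = riccati_op M P" and lim: "riccati_iterate M \<longlonglongrightarrow> P"
    by (rule riccati_iterates_converge[OF M])
  have sol: "riccati_sol M = P" by (rule riccati_sol_eqI[OF M sd P])
  define q where "q = optimal_offset M"
  have \<gamma>: "0 < lqr_gamma M" "lqr_gamma M < 1" using M by (auto simp: lqr_model_def)
  have q: "0 \<le> q" "q = lqr_gamma M * (trace (lqr_Sigma M ** P) + q)"
    using \<gamma> trace_Sigma_nonneg[OF M P(1)]
    by (auto simp: q_def optimal_offset_def sol field_simps)
  have upper: "V s \<le> ennreal (quad_form P s + q)" for s
    by (rule fixpoint_le_quadratic[OF M l P q Vs C S _ \<kappa>])
       (use A in \<open>simp add: opt_gain_riccati_gain sol\<close>)
  have lower: "ennreal (quad_form P s + q) \<le> V s" for s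
  proof (rule LIMSEQ_le_const2)
    show "(\<lambda>k. ennreal (quad_form (riccati_iterate M k) s + iterate_offset M k))
        \<longlonglongrightarrow> ennreal (quad_form P s + q)"
      by (intro tendsto_ennrealI tendsto_add tendsto_quad_form_matrix lim iterate_offset_tendsto[OF M lim q(2)])
    show "\<exists>N. \<forall>n\<ge>N. ennreal (quad_form (riccati_iterate M n) s + iterate_offset M n) \<le> V s"
      using iterates_le_fixpoint[OF M Vs] by blast
  qed
  have "optimal_value M = (\<lambda>s. ennreal (quad_form P s + q))"
    using opt upper lower by (intro ext) (metis antisym)
  then show "psd_mat (riccati_sol M)" "riccati_sol M = riccati_op M (riccati_sol M)"
    "0 \<le> optimal_offset M"
    "optimal_offset M = lqr_gamma M * (trace (lqr_Sigma M ** riccati_sol M) + optimal_offset M)"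
    "optimal_value M = (\<lambda>s. ennreal (quad_form (riccati_sol M) s + optimal_offset M))"
    unfolding sol q_def[symmetric] using P q by auto
qed

section \<open>Values of linear policies\<close>

lemma traj_kernel_0: "traj_kernel M \<pi> s 0 \<omega> = state_action_law \<pi> s"
  by (simp add: traj_kernel_def)

lemma traj_kernel_Suc:
  "traj_kernel M \<pi> s (Suc m) \<omega> = lqr_noise M \<bind>
     (\<lambda>\<xi>. state_action_law \<pi> (lqr_next M (fst (\<omega> m)) (snd (\<omega> m)) \<xi>))"
  by (simp add: traj_kernel_def)

lemma state_action_law_linear_policy:
  fixes K :: "real^'s^'a"
  shows "state_action_law (linear_policy K) s = return borel (s, - (K *v s))"
proof -
  have "(\<lambda>a. (s, a)) \<in> borel \<rightarrow>\<^sub>M (borel :: ((real^'s) \<times> (real^'a)) measure)"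
    by (intro borel_measurable_continuous_onI continuous_intros)
  then show ?thesis
    unfolding state_action_law_def linear_policy_def by (rule distr_return) simp
qed

lemma measurable_matrix_vector_mult [measurable]:
  fixes K :: "real^'n^'m"
  assumes "f \<in> borel_measurable N"
  shows "(\<lambda>x. K *v f x) \<in> borel_measurable N"
  using assms
  by (rule measurable_compose) (intro borel_measurable_continuous_onI
      bounded_linear.continuous_on[OF matrix_vector_mul_bounded_linear] continuous_intros)

lemma measurable_state_action_law_linear:
  "state_action_law (linear_policy (K :: real^'s^'a)) \<in> borel \<rightarrow>\<^sub>M subprob_algebra borel"
proof -
  have "(\<lambda>s. (s, - (K *v s))) \<in> borel \<rightarrow>\<^sub>M borel \<Otimes>\<^sub>M (borel :: (real^'a) measure)"
    by measurable
  then have "(\<lambda>s. (s, - (K *v s))) \<in> borel \<rightarrow>\<^sub>M (borel :: ((real^'s) \<times> (real^'a)) measure)"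
    by (simp add: borel_prod)
  then have "(\<lambda>s. return borel (s, - (K *v s))) \<in> borel \<rightarrow>\<^sub>M subprob_algebra borel"
    by (rule measurable_compose[OF _ return_measurable])
  then show ?thesis unfolding state_action_law_linear_policy[abs_def] .
qed

lemma measurable_lqr_next:
  fixes M :: "('s::finite, 'a::finite) lqr"
  assumes "f \<in> L \<rightarrow>\<^sub>M (borel :: ((real^'s) \<times> (real^'a)) measure)" "g \<in> borel_measurable L"
  shows "(\<lambda>x. lqr_next M (fst (f x)) (snd (f x)) (g x)) \<in> borel_measurable L"
proof -
  have f: "f \<in> L \<rightarrow>\<^sub>M (borel \<Otimes>\<^sub>M borel)" using assms(1) by (simp add: borel_prod)
  have [measurable]: "(\<lambda>x. fst (f x)) \<in> borel_measurable L" "(\<lambda>x. snd (f x)) \<in> borel_measurable L"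
    using measurable_compose[OF f measurable_fst] measurable_compose[OF f measurable_snd] by auto
  note [measurable] = assms(2)
  show ?thesis unfolding lqr_next_def by measurable
qed

lemma noise_in_subprob_algebra:
  "lqr_model M \<Longrightarrow> lqr_noise M \<in> space (subprob_algebra borel)"
  by (simp add: lqr_model_def space_subprob_algebra prob_space_imp_subprob_space)

lemma traj_kernel_measurable:
  fixes M :: "('s::finite, 'a::finite) lqr"
  assumes M: "lqr_model M"
  shows "traj_kernel M (linear_policy K) s i \<in> PiM {0..<i} (\<lambda>_. borel) \<rightarrow>\<^sub>M subprob_algebra borel"
proof (cases i)
  case 0
  have "state_action_law (linear_policy K) s \<in> space (subprob_algebra borel)"
    using measurable_space[OF measurable_state_action_law_linear, of s K] by simp
  then show ?thesis unfolding 0 by (simp add: traj_kernel_0[abs_def])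
next
  case (Suc m)
  let ?L = "PiM {0..<Suc m} (\<lambda>_. borel :: ((real^'s) \<times> (real^'a)) measure)"
  have noise: "(\<lambda>_. lqr_noise M) \<in> ?L \<rightarrow>\<^sub>M subprob_algebra borel"
    by (intro measurable_const noise_in_subprob_algebra M)
  have comp: "(\<lambda>\<omega>. \<omega> m) \<in> ?L \<rightarrow>\<^sub>M borel"
    by (rule measurable_component_singleton) simp
  have "(\<lambda>x. lqr_next M (fst (fst x m)) (snd (fst x m)) (snd x))
      \<in> ?L \<Otimes>\<^sub>M borel \<rightarrow>\<^sub>M borel"
    by (rule measurable_lqr_next[OF measurable_compose[OF measurable_fst comp] measurable_snd])
  from measurable_bind[OF noise measurable_compose[OF this measurable_state_action_law_linear]]
  show ?thesis unfolding Suc traj_kernel_Suc[abs_def] .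
qed

lemma measurable_next_law:
  fixes M :: "('s::finite, 'a::finite) lqr"
  assumes M: "lqr_model M"
  shows "(\<lambda>\<xi>. state_action_law (linear_policy K) (lqr_next M s a \<xi>))
           \<in> lqr_noise M \<rightarrow>\<^sub>M subprob_algebra borel"
proof -
  have sets: "sets (lqr_noise M) = sets borel" using M by (simp add: lqr_model_def)
  have "lqr_next M s a \<in> borel_measurable borel"
    unfolding lqr_next_def[abs_def] by measurable
  from measurable_compose[OF this measurable_state_action_law_linear]
  show ?thesis by (simp add: measurable_cong_sets[OF sets refl])
qed

lemma traj_kernel_prob_space:
  fixes M :: "('s::finite, 'a::finite) lqr"
  assumes M: "lqr_model M"
  shows "prob_space (traj_kernel M (linear_policy K) s i \<omega>)"
proof (cases i)
  case 0
  then show ?thesis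
    by (simp add: traj_kernel_0 state_action_law_linear_policy prob_space_return)
next
  case (Suc m)
  interpret prob_space "lqr_noise M" using M by (simp add: lqr_model_def)
  show ?thesis
    unfolding Suc traj_kernel_Suc
    by (rule prob_space_bind[OF _ measurable_next_law[OF M]])
       (simp add: state_action_law_linear_policy prob_space_return)
qed

lemma Ionescu_Tulcea_traj_kernel:
  "lqr_model M \<Longrightarrow> Ionescu_Tulcea (traj_kernel M (linear_policy K) s) (\<lambda>_. borel)"
  by (intro Ionescu_Tulcea.intro traj_kernel_measurable traj_kernel_prob_space)

lemma nn_integral_traj_kernel_Suc:
  fixes M :: "('s::finite, 'a::finite) lqr"
  assumes M: "lqr_model M" and f: "f \<in> borel_measurable borel"
  shows "(\<integral>\<^sup>+z. f z \<partial>traj_kernel M (linear_policy K) s (Suc m) \<omega>)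
    = (\<integral>\<^sup>+\<xi>. f (lqr_next M (fst (\<omega> m)) (snd (\<omega> m)) \<xi>,
               - (K *v lqr_next M (fst (\<omega> m)) (snd (\<omega> m)) \<xi>)) \<partial>lqr_noise M)"
  unfolding traj_kernel_Suc
  by (subst nn_integral_bind[OF f measurable_next_law[OF M]], unfold state_action_law_linear_policy,
      intro nn_integral_cong nn_integral_return) (use f in auto)

definition closed_loop_step ::
    "('s::finite, 'a::finite) lqr \<Rightarrow> real^'s^'a \<Rightarrow> (real^'s \<Rightarrow> ennreal) \<Rightarrow> real^'s \<Rightarrow> ennreal" where
  "closed_loop_step M K h s = (\<integral>\<^sup>+\<xi>. h (closed_loop M K *v s + \<xi>) \<partial>lqr_noise M)"

lemma closed_loop_step_lqr_next:
  "closed_loop_step M K h s = (\<integral>\<^sup>+\<xi>. h (lqr_next M s (- (K *v s)) \<xi>) \<partial>lqr_noise M)"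
  by (simp add: closed_loop_step_def lqr_next_def closed_loop_mult del: add_uminus_conv_diff)

lemma borel_measurable_noise_integral:
  fixes M :: "('s::finite, 'a::finite) lqr"
  assumes M: "lqr_model M"
    and h: "(\<lambda>x. h (fst x) (snd x)) \<in> borel_measurable (L \<Otimes>\<^sub>M borel)"
  shows "(\<lambda>z. \<integral>\<^sup>+\<xi>. h z \<xi> \<partial>lqr_noise M) \<in> borel_measurable L"
proof -
  interpret prob_space "lqr_noise M" using M by (simp add: lqr_model_def)
  have sets: "sets (lqr_noise M) = sets borel" using M by (simp add: lqr_model_def)
  have "sets (L \<Otimes>\<^sub>M lqr_noise M) = sets (L \<Otimes>\<^sub>M borel)"
    by (intro sets_pair_measure_cong sets refl)
  from h have "(\<lambda>(z, \<xi>). h z \<xi>) \<in> borel_measurable (L \<Otimes>\<^sub>M lqr_noise M)"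
    by (simp add: measurable_cong_sets[OF \<open>sets (L \<Otimes>\<^sub>M lqr_noise M) = _\<close> refl] case_prod_beta)
  then show ?thesis by (rule borel_measurable_nn_integral)
qed

lemma borel_measurable_closed_loop_step:
  fixes M :: "('s::finite, 'a::finite) lqr"
  assumes M: "lqr_model M" and h: "h \<in> borel_measurable borel"
  shows "closed_loop_step M K h \<in> borel_measurable borel"
  unfolding closed_loop_step_def[abs_def]
  by (intro borel_measurable_noise_integral[OF M] measurable_compose[OF _ h]) measurable

text \<open>
  The expectation of a function of the state-action pair at time \<open>n\<close> is peeled off from the end: integrating
  out the last kernel turns it into the expectation of another function at time \<open>n - 1\<close>, namely the
  closed-loop step of the former.
\<close>

lemma traj_marginal:
  fixes M :: "('s::finite, 'a::finite) lqr"
    and f :: "(real^'s) \<times> (real^'a) \<Rightarrow> ennreal"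
  assumes M: "lqr_model M" and f: "f \<in> borel_measurable borel"
  shows "(\<integral>\<^sup>+\<omega>. f (\<omega> n) \<partial>traj_measure M (linear_policy K) s)
           = (closed_loop_step M K ^^ n) (\<lambda>s. f (s, - (K *v s))) s"
proof -
  interpret IT: Ionescu_Tulcea "traj_kernel M (linear_policy K) s" "\<lambda>_. borel"
    by (rule Ionescu_Tulcea_traj_kernel[OF M])
  \<comment> \<open>The empty history, from which the Ionescu-Tulcea construction starts.\<close>
  define u :: "nat \<Rightarrow> (real^'s) \<times> (real^'a)" where "u = (\<lambda>_. undefined)"
  have u: "u \<in> space (PiM {0..<0} (\<lambda>_. borel))" by (simp add: u_def space_PiM)
  have comp: "(\<lambda>x. x i) \<in> PiM {0..<Suc i} (\<lambda>_. borel :: ((real^'s) \<times> (real^'a)) measure) \<rightarrow>\<^sub>M borel"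
    for i :: nat
    by (rule measurable_component_singleton) simp
  have step: "(\<integral>\<^sup>+x. g (x n) \<partial>IT.C 0 (Suc n) u)
      = (\<integral>\<^sup>+x. (\<integral>\<^sup>+z. g z \<partial>traj_kernel M (linear_policy K) s n x) \<partial>IT.C 0 n u)"
    if g: "g \<in> borel_measurable borel" for g n
  proof -
    have gm: "(\<lambda>x. g (x n)) \<in> borel_measurable (PiM {0..<Suc n} (\<lambda>_. borel))"
      by (rule measurable_compose[OF comp g])
    have eP: "IT.eP n \<in> IT.C 0 n u \<rightarrow>\<^sub>M subprob_algebra (PiM {0..<Suc n} (\<lambda>_. borel))"
      using IT.measurable_eP[of n] by (simp add: measurable_cong_sets[OF IT.sets_C[OF u] refl])
    have "(\<integral>\<^sup>+x. g (x n) \<partial>IT.C 0 (Suc n) u)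
        = (\<integral>\<^sup>+x. (\<integral>\<^sup>+y. g (y n) \<partial>IT.eP n x) \<partial>IT.C 0 n u)"
      using nn_integral_bind[OF gm eP] by simp
    also have "\<dots> = (\<integral>\<^sup>+x. (\<integral>\<^sup>+z. g z \<partial>traj_kernel M (linear_policy K) s n x) \<partial>IT.C 0 n u)"
      using gm by (intro nn_integral_cong) (simp add: IT.nn_integral_eP IT.space_C[OF u])
    finally show ?thesis .
  qed
  have C: "(\<integral>\<^sup>+x. g (x n) \<partial>IT.C 0 (Suc n) u)
      = (closed_loop_step M K ^^ n) (\<lambda>s. g (s, - (K *v s))) s"
    if g: "g \<in> borel_measurable borel" for g n
    using g
  proof (induction n arbitrary: g)
    case 0
    have m: "(\<lambda>x. \<integral>\<^sup>+z. g z \<partial>traj_kernel M (linear_policy K) s 0 x)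
        \<in> borel_measurable (PiM {0..<0} (\<lambda>_. borel))"
      unfolding traj_kernel_0 by simp
    have "(\<integral>\<^sup>+x. g (x 0) \<partial>IT.C 0 (Suc 0) u)
        = (\<integral>\<^sup>+z. g z \<partial>traj_kernel M (linear_policy K) s 0 u)"
      by (subst step[OF 0], unfold IT.C.simps(1), rule nn_integral_return[OF u m])
    also have "\<dots> = g (s, - (K *v s))"
      unfolding traj_kernel_0 state_action_law_linear_policy
      using 0 by (intro nn_integral_return) auto
    finally show ?case by simp
  next
    case (Suc m)
    define g' where "g' z = (\<integral>\<^sup>+\<xi>. g (lqr_next M (fst z) (snd z) \<xi>,
        - (K *v lqr_next M (fst z) (snd z) \<xi>)) \<partial>lqr_noise M)" for z
    have next_m: "(\<lambda>x. lqr_next M (fst (fst x)) (snd (fst x)) (snd x))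
        \<in> borel \<Otimes>\<^sub>M borel \<rightarrow>\<^sub>M borel"
      by (rule measurable_lqr_next[OF measurable_fst measurable_snd])
    have "(\<lambda>s. (s, - (K *v s))) \<in> borel \<rightarrow>\<^sub>M borel \<Otimes>\<^sub>M (borel :: (real^'a) measure)"
      by measurable
    then have pair: "(\<lambda>s. (s, - (K *v s))) \<in> borel \<rightarrow>\<^sub>M (borel :: ((real^'s) \<times> (real^'a)) measure)"
      by (simp add: borel_prod)
    have g': "g' \<in> borel_measurable borel"
      unfolding g'_def[abs_def]
      by (rule borel_measurable_noise_integral[OF M])
         (rule measurable_compose[OF next_m measurable_compose[OF pair Suc.prems]])
    have "(\<integral>\<^sup>+x. g (x (Suc m)) \<partial>IT.C 0 (Suc (Suc m)) u) = (\<integral>\<^sup>+x. g' (x m) \<partial>IT.C 0 (Suc m) u)"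
      unfolding step[OF Suc.prems] nn_integral_traj_kernel_Suc[OF M Suc.prems] g'_def ..
    also have "\<dots> = (closed_loop_step M K ^^ m) (\<lambda>s. g' (s, - (K *v s))) s"
      by (rule Suc.IH[OF g'])
    also have "(\<lambda>s. g' (s, - (K *v s))) = closed_loop_step M K (\<lambda>s. g (s, - (K *v s)))"
      by (simp add: fun_eq_iff g'_def closed_loop_step_lqr_next)
    finally show ?case by (simp add: funpow_swap1)
  qed
  let ?J = "{0..<Suc n}"
  have up: "IT.up_to ?J = Suc n"
    using IT.up_to_iff_Ico[of ?J "Suc n"] IT.up_to_less[of ?J n] by simp
  have restr: "(\<lambda>x. restrict x ?J) \<in> PiM I (\<lambda>_. borel) \<rightarrow>\<^sub>M PiM ?J (\<lambda>_. borel :: ((real^'s) \<times> (real^'a)) measure)"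
    if "?J \<subseteq> I" for I
    by (rule measurable_restrict_subset[OF that])
  have fm: "(\<lambda>x. f (x n)) \<in> borel_measurable (PiM ?J (\<lambda>_. borel))"
    by (rule measurable_compose[OF comp f])
  have lim: "traj_measure M (linear_policy K) s = IT.PF.lim"
    by (simp add: traj_measure_def)
  have "(\<integral>\<^sup>+\<omega>. f (\<omega> n) \<partial>IT.PF.lim)
      = (\<integral>\<^sup>+x. f (x n) \<partial>distr IT.PF.lim (PiM ?J (\<lambda>_. borel)) (\<lambda>x. restrict x ?J))"
    using restr[of UNIV] fm
    by (subst nn_integral_distr) (auto simp: measurable_cong_sets[OF IT.PF.sets_lim refl])
  also have "\<dots> = (\<integral>\<^sup>+x. f (x n) \<partial>IT.CI ?J)"
    by (subst IT.distr_lim) auto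
  also have "\<dots> = (\<integral>\<^sup>+x. f (x n) \<partial>IT.C 0 (Suc n) u)"
    unfolding IT.CI_def up u_def[symmetric]
    using restr[of "{0..<0 + Suc n}"] fm
    by (subst nn_integral_distr)
       (auto simp: measurable_cong_sets[OF IT.sets_C[OF u] refl] simp del: IT.C.simps)
  also have "\<dots> = (closed_loop_step M K ^^ n) (\<lambda>s. f (s, - (K *v s))) s"
    by (rule C[OF f])
  finally show ?thesis unfolding lim .
qed

lemma closed_loop_step_add:
  fixes M :: "('s::finite, 'a::finite) lqr"
  assumes M: "lqr_model M" and "f \<in> borel_measurable borel" "g \<in> borel_measurable borel"
  shows "closed_loop_step M K (\<lambda>s. f s + g s) s = closed_loop_step M K f s + closed_loop_step M K g s"
proof -
  have sets: "sets (lqr_noise M) = sets borel" using M by (simp add: lqr_model_def)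
  have meas: "(\<lambda>\<xi>. h (closed_loop M K *v s + \<xi>)) \<in> borel_measurable (lqr_noise M)"
    if "h \<in> borel_measurable borel" for h :: "real^'s \<Rightarrow> ennreal"
    unfolding measurable_cong_sets[OF sets refl]
    by (rule measurable_compose[OF _ that]) measurable
  show ?thesis
    unfolding closed_loop_step_def by (rule nn_integral_add[OF meas[OF assms(2)] meas[OF assms(3)]])
qed

lemma closed_loop_step_cmult:
  fixes M :: "('s::finite, 'a::finite) lqr"
  assumes M: "lqr_model M" and f: "f \<in> borel_measurable borel"
  shows "closed_loop_step M K (\<lambda>s. c * f s) s = c * closed_loop_step M K f s"
proof -
  have sets: "sets (lqr_noise M) = sets borel" using M by (simp add: lqr_model_def)
  have "(\<lambda>\<xi>. f (closed_loop M K *v s + \<xi>)) \<in> borel_measurable (lqr_noise M)"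
    unfolding measurable_cong_sets[OF sets refl]
    by (rule measurable_compose[OF _ f]) measurable
  then show ?thesis unfolding closed_loop_step_def by (rule nn_integral_cmult)
qed

lemma borel_measurable_closed_loop_step_funpow:
  "lqr_model M \<Longrightarrow> h \<in> borel_measurable borel \<Longrightarrow> (closed_loop_step M K ^^ t) h \<in> borel_measurable borel"
  by (induction t) (simp_all add: borel_measurable_closed_loop_step)

definition policy_cost :: "('s::finite, 'a::finite) lqr \<Rightarrow> real^'s^'a \<Rightarrow> real^'s \<Rightarrow> ennreal" where
  "policy_cost M K s = ennreal (lqr_cost M s (- (K *v s)))"

lemma borel_measurable_lqr_cost:
  fixes M :: "('s::finite, 'a::finite) lqr"
  shows "(\<lambda>z. ennreal (lqr_cost M (fst z) (snd z))) \<in> borel_measurable borel"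
  unfolding lqr_cost_def
  by (intro measurable_compose[OF _ measurable_ennreal] borel_measurable_continuous_onI
      continuous_intros bounded_linear.continuous_on[OF matrix_vector_mul_bounded_linear])

lemma borel_measurable_policy_cost:
  fixes M :: "('s::finite, 'a::finite) lqr"
  shows "policy_cost M K \<in> borel_measurable borel"
  unfolding policy_cost_def[abs_def] lqr_cost_def
  by (intro measurable_compose[OF _ measurable_ennreal] borel_measurable_continuous_onI
      continuous_intros bounded_linear.continuous_on[OF matrix_vector_mul_bounded_linear])

text \<open>
  The discounted cost of the linear policy over the first \<open>n\<close> steps.
\<close>

definition truncated_value ::
    "('s::finite, 'a::finite) lqr \<Rightarrow> real^'s^'a \<Rightarrow> nat \<Rightarrow> real^'s \<Rightarrow> ennreal" where
  "truncated_value M K n s =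
     (\<Sum>t<n. ennreal (lqr_gamma M ^ t) * (closed_loop_step M K ^^ t) (policy_cost M K) s)"

lemma borel_measurable_truncated_value:
  fixes M :: "('s::finite, 'a::finite) lqr"
  assumes M: "lqr_model M"
  shows "truncated_value M K n \<in> borel_measurable borel"
  unfolding truncated_value_def[abs_def]
  by (intro borel_measurable_sum borel_measurable_times_ennreal borel_measurable_const
      borel_measurable_closed_loop_step_funpow[OF M] borel_measurable_policy_cost)

lemma truncated_value_tendsto:
  fixes M :: "('s::finite, 'a::finite) lqr"
  assumes M: "lqr_model M"
  shows "(\<lambda>n. truncated_value M K n s) \<longlonglongrightarrow> policy_value M (linear_policy K) s"
proof -
  interpret IT: Ionescu_Tulcea "traj_kernel M (linear_policy K) s" "\<lambda>_. borel"
    by (rule Ionescu_Tulcea_traj_kernel[OF M])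
  have sets: "sets (traj_measure M (linear_policy K) s) = sets (PiM UNIV (\<lambda>_. borel))"
    unfolding traj_measure_def by (rule IT.PF.sets_lim)
  have \<gamma>: "0 < lqr_gamma M" using M by (simp add: lqr_model_def)
  define f where "f z = ennreal (lqr_cost M (fst z) (snd z))" for z
  have f: "f \<in> borel_measurable borel" unfolding f_def[abs_def] by (rule borel_measurable_lqr_cost)
  have ft: "(\<lambda>\<omega>. f (\<omega> t)) \<in> borel_measurable (traj_measure M (linear_policy K) s)" for t :: nat
    unfolding measurable_cong_sets[OF sets refl]
    by (rule measurable_compose[OF measurable_component_singleton[where M = "\<lambda>_. borel"] f]) simp
  have "policy_value M (linear_policy K) s
      = (\<integral>\<^sup>+\<omega>. (\<Sum>t. ennreal (lqr_gamma M ^ t) * f (\<omega> t)) \<partial>traj_measure M (linear_policy K) s)"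
    unfolding policy_value_def f_def using \<gamma> lqr_cost_nonneg[OF M] by (simp add: ennreal_mult)
  also have "\<dots> = (\<Sum>t. \<integral>\<^sup>+\<omega>. ennreal (lqr_gamma M ^ t) * f (\<omega> t) \<partial>traj_measure M (linear_policy K) s)"
    by (intro nn_integral_suminf borel_measurable_times_ennreal borel_measurable_const ft)
  also have "\<dots> = (\<Sum>t. ennreal (lqr_gamma M ^ t)
      * (closed_loop_step M K ^^ t) (\<lambda>s. f (s, - (K *v s))) s)"
    unfolding nn_integral_cmult[OF ft] traj_marginal[OF M f] ..
  also have "(\<lambda>s. f (s, - (K *v s))) = policy_cost M K"
    by (simp add: f_def policy_cost_def fun_eq_iff)
  finally show ?thesis
    unfolding truncated_value_def using summable_LIMSEQ[OF summableI] by simp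
qed

text \<open>
  The truncated value is defined by adding costs at the end of the horizon; this recursion extends the
  horizon at the beginning instead, which is the direction in which Bellman operators act.
\<close>

lemma truncated_value_Suc:
  fixes M :: "('s::finite, 'a::finite) lqr"
  assumes M: "lqr_model M"
  shows "truncated_value M K (Suc n) s
    = policy_cost M K s + ennreal (lqr_gamma M) * closed_loop_step M K (truncated_value M K n) s"
proof -
  let ?T = "closed_loop_step M K"
  let ?c = "policy_cost M K"
  let ?\<gamma> = "lqr_gamma M"
  have \<gamma>: "0 < ?\<gamma>" using M by (simp add: lqr_model_def)
  have meas: "(?T ^^ t) ?c \<in> borel_measurable borel" for t
    by (rule borel_measurable_closed_loop_step_funpow[OF M borel_measurable_policy_cost])
  have T_sum: "?T (truncated_value M K n) s = (\<Sum>t<n. ennreal (?\<gamma> ^ t) * (?T ^^ Suc t) ?c s)" for n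
  proof (induction n)
    case 0
    then show ?case by (simp add: truncated_value_def closed_loop_step_def)
  next
    case (Suc n)
    have "truncated_value M K (Suc n)
        = (\<lambda>s. truncated_value M K n s + ennreal (?\<gamma> ^ n) * (?T ^^ n) ?c s)"
      by (simp add: truncated_value_def fun_eq_iff)
    then have "?T (truncated_value M K (Suc n)) s
        = ?T (truncated_value M K n) s + ?T (\<lambda>s. ennreal (?\<gamma> ^ n) * (?T ^^ n) ?c s) s"
      using closed_loop_step_add[OF M borel_measurable_truncated_value[OF M]
          borel_measurable_times_ennreal[OF borel_measurable_const meas]] by simp
    then show ?case by (simp add: Suc closed_loop_step_cmult[OF M meas])
  qed
  have "truncated_value M K (Suc n) s
      = ?c s + (\<Sum>t<n. ennreal (?\<gamma> ^ Suc t) * (?T ^^ Suc t) ?c s)"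
    unfolding truncated_value_def sum.lessThan_Suc_shift by simp
  also have "\<dots> = ?c s + ennreal ?\<gamma> * (\<Sum>t<n. ennreal (?\<gamma> ^ t) * (?T ^^ Suc t) ?c s)"
    using \<gamma> by (simp add: sum_distrib_left ennreal_mult mult.assoc del: funpow.simps)
  finally show ?thesis unfolding T_sum .
qed

text \<open>
  The Lyapunov operator of the gain \<open>K\<close>. For the optimal gain of the approximate model, its residual at
  the Riccati solution of that model is the matrix \<open>D_policy\<close>.
\<close>

definition evaluation_op :: "('s::finite, 'a::finite) lqr \<Rightarrow> real^'s^'a \<Rightarrow> real^'s^'s \<Rightarrow> real^'s^'s" where
  "evaluation_op M K X = lqr_Q M + transpose K ** lqr_R M ** K
     + lqr_gamma M *\<^sub>R (transpose (closed_loop M K) ** X ** closed_loop M K)"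

lemma quad_form_evaluation_op:
  "quad_form (evaluation_op M K X) s = lookahead_cost M X s (- (K *v s))"
proof -
  have "quad_form (lqr_R M) (- (K *v s)) = quad_form (lqr_R M) (K *v s)"
    using quad_form_scaled_vector[of _ "-1"] by simp
  then show ?thesis
    unfolding evaluation_op_def lookahead_cost_def closed_loop_mult
    by (simp add: quad_form_add quad_form_scaleR quad_form_congruence lqr_cost_quad_form)
qed

lemma transpose_evaluation_op:
  assumes M: "lqr_model M" and X: "transpose X = X"
  shows "transpose (evaluation_op M K X) = evaluation_op M K X"
  using M X
  by (simp add: evaluation_op_def transpose_add transpose_scalar transpose_congruence
      lqr_model_def psd_mat_def pd_mat_def)

lemma evaluation_op_psd:
  assumes M: "lqr_model M" and X: "psd_mat X"
  shows "psd_mat (evaluation_op M K X)"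
  using transpose_evaluation_op[OF M] X lookahead_cost_nonneg[OF M X]
  by (simp add: psd_mat_alt quad_form_evaluation_op)

lemma truncated_value_Suc_q_value:
  assumes M: "lqr_model M"
  shows "truncated_value M K (Suc n) s = q_value M (truncated_value M K n) s (- (K *v s))"
  unfolding truncated_value_Suc[OF M] q_value_def policy_cost_def closed_loop_step_lqr_next ..

lemma truncated_value_quadratic:
  fixes M :: "('s::finite, 'a::finite) lqr"
  assumes M: "lqr_model M"
  obtains X y where "psd_mat X" "0 \<le> y" "truncated_value M K n = (\<lambda>s. ennreal (quad_form X s + y))"
    "truncated_value M K (Suc n) = (\<lambda>s. ennreal (quad_form (evaluation_op M K X) s
        + lqr_gamma M * (trace (lqr_Sigma M ** X) + y)))"
proof -
  have \<gamma>: "0 < lqr_gamma M" using M by (simp add: lqr_model_def)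
  have step: "truncated_value M K (Suc n) = (\<lambda>s. ennreal (quad_form (evaluation_op M K X) s
        + lqr_gamma M * (trace (lqr_Sigma M ** X) + y)))"
    if "psd_mat X" "0 \<le> y" "truncated_value M K n = (\<lambda>s. ennreal (quad_form X s + y))" for n X y
    unfolding truncated_value_Suc_q_value[OF M, abs_def] that(3) q_value_quad_form[OF M that(1,2)]
      quad_form_evaluation_op ..
  have "\<exists>X y. psd_mat X \<and> 0 \<le> y \<and> truncated_value M K n = (\<lambda>s. ennreal (quad_form X s + y))"
  proof (induction n)
    case 0
    show ?case
      by (intro exI[of _ 0]) (simp add: psd_mat_zero truncated_value_def fun_eq_iff)
  next
    case (Suc n)
    then obtain X y where X: "psd_mat X" and y: "0 \<le> y"
      and eq: "truncated_value M K n = (\<lambda>s. ennreal (quad_form X s + y))" by blast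
    have "0 \<le> lqr_gamma M * (trace (lqr_Sigma M ** X) + y)"
      using \<gamma> y trace_Sigma_nonneg[OF M X] by simp
    then show ?case using step[OF X y eq] evaluation_op_psd[OF M X] by blast
  qed
  then show ?thesis using step that by blast
qed

section \<open>Comparison with a shifted quadratic function\<close>

text \<open>
  The two parts of the weight \<open>1 + l \<bar>s\<bar>\<^sup>2\<close> absorb the constant and the quadratic part separately.
\<close>

lemma abs_quadratic_le_weight:
  fixes D :: "real^'n^'n"
  assumes D: "transpose D = D" and l: "0 < l"
  shows "\<bar>quad_form D s + d\<bar> \<le> max (mat_spectral_radius D / l) \<bar>d\<bar> * quad_weight l s"
proof -
  let ?m = "max (mat_spectral_radius D / l) \<bar>d\<bar>"
  have "mat_spectral_radius D \<le> ?m * l" using l by (simp add: pos_divide_le_eq[symmetric])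
  then have "mat_spectral_radius D * (s \<bullet> s) \<le> ?m * l * (s \<bullet> s)"
    by (rule mult_right_mono) simp
  then have "\<bar>quad_form D s\<bar> + \<bar>d\<bar> \<le> ?m * l * (s \<bullet> s) + ?m"
    using abs_quad_form_le_mat_spectral_radius[OF D, of s] by linarith
  then show ?thesis
    using abs_triangle_ineq[of "quad_form D s" d] by (simp add: quad_weight_def algebra_simps)
qed

lemma quadratic_has_weight_bound:
  fixes X :: "real^'n^'n"
  assumes l: "0 < l"
  obtains N where "0 \<le> N" "\<And>s. \<bar>quad_form X s + c\<bar> \<le> N * quad_weight l s"
proof
  let ?N = "max (entry_sum X / l) \<bar>c\<bar>"
  show "0 \<le> ?N" by simp
  fix s :: "real^'n"
  have "entry_sum X \<le> ?N * l" using l by (simp add: pos_divide_le_eq[symmetric])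
  then have "entry_sum X * (s \<bullet> s) \<le> ?N * l * (s \<bullet> s)"
    by (rule mult_right_mono) simp
  then have "\<bar>quad_form X s\<bar> + \<bar>c\<bar> \<le> ?N * l * (s \<bullet> s) + ?N"
    using abs_quad_form_le_entry_sum[of X s] by linarith
  then show "\<bar>quad_form X s + c\<bar> \<le> ?N * quad_weight l s"
    using abs_triangle_ineq[of "quad_form X s" c] by (simp add: quad_weight_def algebra_simps)
qed

text \<open>
  The errors of the truncated values obey \<open>e\<^bsub>n+1\<^esub> \<le> \<epsilon> + \<gamma> \<kappa> e\<^bsub>n\<^esub>\<close>, where \<open>\<epsilon>\<close> bounds the Bellman residual of
  the comparison function. The resulting bounds also show that the value of the policy is finite.
\<close>

lemma policy_value_error:
  fixes M :: "('s::finite, 'a::finite) lqr"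
  assumes M: "lqr_model M" and l: "0 < l" and P: "transpose P = P"
    and S: "1 + l * trace (lqr_Sigma M) \<le> \<kappa>"
    and A: "\<And>s. (closed_loop M K *v s) \<bullet> (closed_loop M K *v s) \<le> \<kappa> * (s \<bullet> s)"
    and \<kappa>: "0 \<le> \<kappa>" "lqr_gamma M * \<kappa> < 1"
    and \<epsilon>: "0 \<le> \<epsilon>" "\<And>s. \<bar>quad_form (evaluation_op M K P - P) s
        + (lqr_gamma M * (trace (lqr_Sigma M ** P) + c) - c)\<bar> \<le> \<epsilon> * quad_weight l s"
  obtains v where "0 \<le> v" "policy_value M (linear_policy K) s = ennreal v"
    "\<bar>v - (quad_form P s + c)\<bar> \<le> \<epsilon> / (1 - lqr_gamma M * \<kappa>) * quad_weight l s"
proof -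
  define \<gamma> \<beta> where "\<gamma> = lqr_gamma M" and "\<beta> = lqr_gamma M * \<kappa>"
  have \<gamma>: "0 < \<gamma>" using M by (simp add: lqr_model_def \<gamma>_def)
  have \<beta>: "0 \<le> \<beta>" "\<beta> < 1" using \<kappa> \<gamma> by (auto simp: \<beta>_def \<gamma>_def)
  define W where "W n s = enn2real (truncated_value M K n s)" for n s
  \<comment> \<open>The fixed point of the error recursion.\<close>
  define b where "b = \<epsilon> / (1 - \<beta>)"
  have b: "\<epsilon> + \<beta> * b = b" "0 \<le> b" using \<beta> \<epsilon> by (auto simp: b_def field_simps)
  obtain N where N: "0 \<le> N" "\<And>s. \<bar>quad_form P s + c\<bar> \<le> N * quad_weight l s"
    using quadratic_has_weight_bound[OF l] by metis
  have err: "\<bar>W n s - (quad_form P s + c)\<bar> \<le> (b + \<beta> ^ n * N) * quad_weight l s" for n s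
  proof (induction n arbitrary: s)
    case 0
    have "N * quad_weight l s \<le> (b + \<beta> ^ 0 * N) * quad_weight l s"
      using b quad_weight_ge_1[OF l, of s] by (intro mult_right_mono) auto
    then show ?case using N(2)[of s] by (simp add: W_def truncated_value_def)
  next
    case (Suc n)
    obtain X y where X: "psd_mat X" "0 \<le> y"
      and Wn: "truncated_value M K n = (\<lambda>s. ennreal (quad_form X s + y))"
      and WS: "truncated_value M K (Suc n) = (\<lambda>s. ennreal (quad_form (evaluation_op M K X) s
        + lqr_gamma M * (trace (lqr_Sigma M ** X) + y)))"
      using truncated_value_quadratic[OF M] by metis
    have n: "W n s = quad_form X s + y" for s
    proof -
      have "0 \<le> quad_form X s + y" using X by (simp add: psd_mat_alt)
      then show ?thesis by (simp add: W_def Wn del: ennreal_plus)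
    qed
    have S: "W (Suc n) s = quad_form (evaluation_op M K X) s + \<gamma> * (trace (lqr_Sigma M ** X) + y)" for s
    proof -
      have "0 \<le> quad_form (evaluation_op M K X) s"
        using evaluation_op_psd[OF M X(1)] by (simp add: psd_mat_alt)
      moreover have "0 \<le> \<gamma> * (trace (lqr_Sigma M ** X) + y)"
        using trace_Sigma_nonneg[OF M X(1)] X(2) \<gamma> by simp
      ultimately show ?thesis by (simp add: W_def WS \<gamma>_def del: ennreal_plus)
    qed
    let ?z = "closed_loop M K *v s"
    let ?D = "quad_form (evaluation_op M K P - P) s + (\<gamma> * (trace (lqr_Sigma M ** P) + c) - c)"
    have sym: "transpose (X - P) = X - P" using X(1) P by (simp add: transpose_diff psd_mat_def)
    have e: "0 \<le> b + \<beta> ^ n * N" using b \<beta> N(1) by simp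
    have "\<bar>quad_form (X - P) s + (y - c)\<bar> \<le> (b + \<beta> ^ n * N) * quad_weight l s" for s
      using Suc[of s] by (simp add: n quad_form_diff algebra_simps)
    then have step: "\<bar>quad_form (X - P) ?z + trace (lqr_Sigma M ** (X - P)) + (y - c)\<bar>
        \<le> (b + \<beta> ^ n * N) * (\<kappa> * quad_weight l s)"
      by (rule expected_quad_form_contraction[OF M sym l assms(4) A e])
    have "trace (lqr_Sigma M ** X) = trace (lqr_Sigma M ** (X - P)) + trace (lqr_Sigma M ** P)"
      using trace_mult_add[of "lqr_Sigma M" "X - P" P] by simp
    then have "W (Suc n) s - (quad_form P s + c)
        = \<gamma> * (quad_form (X - P) ?z + trace (lqr_Sigma M ** (X - P)) + (y - c)) + ?D"
      unfolding S
      by (simp add: quad_form_evaluation_op lookahead_cost_def closed_loop_mult quad_form_diff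
          \<gamma>_def[symmetric] algebra_simps del: add_uminus_conv_diff)
    then have "\<bar>W (Suc n) s - (quad_form P s + c)\<bar>
        \<le> \<gamma> * \<bar>quad_form (X - P) ?z + trace (lqr_Sigma M ** (X - P)) + (y - c)\<bar> + \<bar>?D\<bar>"
      using \<gamma> by (metis abs_mult abs_of_pos abs_triangle_ineq)
    also have "\<dots> \<le> \<gamma> * ((b + \<beta> ^ n * N) * (\<kappa> * quad_weight l s)) + \<epsilon> * quad_weight l s"
      using \<gamma> step \<epsilon>(2)[of s] by (intro add_mono mult_left_mono) (auto simp: \<gamma>_def)
    also have "\<dots> = ((\<epsilon> + \<beta> * b) + \<beta> ^ Suc n * N) * quad_weight l s"
      by (simp add: \<beta>_def \<gamma>_def algebra_simps)
    finally show ?case unfolding b(1) .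
  qed
  have tv: "truncated_value M K n s = ennreal (W n s)" for n s
    using truncated_value_quadratic[OF M, of K n]
    by (metis W_def ennreal_enn2real ennreal_less_top)
  have lim: "(\<lambda>n. ennreal (W n s)) \<longlonglongrightarrow> policy_value M (linear_policy K) s"
    using truncated_value_tendsto[OF M, of K s] by (simp add: tv)
  define B where "B = \<bar>quad_form P s + c\<bar> + (b + N) * quad_weight l s"
  have "W n s \<le> B" for n
  proof -
    have "\<beta> ^ n * N \<le> N" using \<beta> N(1) by (simp add: mult_left_le_one_le power_le_one)
    then have "(b + \<beta> ^ n * N) * quad_weight l s \<le> (b + N) * quad_weight l s"
      using quad_weight_ge_1[OF l, of s] by (intro mult_right_mono) auto
    then show ?thesis using err[of n s] unfolding B_def by linarith
  qed
  then have "policy_value M (linear_policy K) s \<le> ennreal B"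
    by (intro LIMSEQ_le_const2[OF lim] exI allI impI ennreal_leI)
  then obtain v where v: "policy_value M (linear_policy K) s = ennreal v" "0 \<le> v"
    by (metis ennreal_cases ennreal_less_top infinity_ennreal_def leD)
  have "(\<lambda>n. W n s) \<longlonglongrightarrow> v"
    using lim v by (simp add: tendsto_ennreal_iff W_def)
  then have "(\<lambda>n. \<bar>W n s - (quad_form P s + c)\<bar>) \<longlonglongrightarrow> \<bar>v - (quad_form P s + c)\<bar>"
    by (intro tendsto_intros)
  moreover have "(\<lambda>n. (b + \<beta> ^ n * N) * quad_weight l s) \<longlonglongrightarrow> (b + 0 * N) * quad_weight l s"
    using \<beta> by (intro tendsto_intros LIMSEQ_realpow_zero) auto
  ultimately have "\<bar>v - (quad_form P s + c)\<bar> \<le> (b + 0 * N) * quad_weight l s"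
    using err by (intro LIMSEQ_le) auto
  then show ?thesis
    using that[OF v(2,1)] by (simp add: b_def \<beta>_def)
qed

text \<open>
  Let \<open>f\<close> be the difference of the two quadratic functions. Using in both problems the gain that is
  optimal for \<open>X\<close> bounds \<open>f\<close> from above by its discounted expectation plus the residual; using the gain
  that is optimal for \<open>P\<close> bounds it from below in the same way. A weighted bound on \<open>f\<close> therefore improves
  itself, with limit \<open>\<epsilon> / (1 - \<gamma> \<kappa>)\<close>.
\<close>

lemma optimal_value_error:
  fixes M :: "('s::finite, 'a::finite) lqr"
  assumes M: "lqr_model M" and l: "0 < l"
    and P: "psd_mat P" "P = riccati_op M P" and q: "q = lqr_gamma M * (trace (lqr_Sigma M ** P) + q)"
    and X: "psd_mat X"
    and S: "1 + l * trace (lqr_Sigma M) \<le> \<kappa>"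
    and AP: "\<And>s. (closed_loop M (riccati_gain M P) *v s) \<bullet> (closed_loop M (riccati_gain M P) *v s)
              \<le> \<kappa> * (s \<bullet> s)"
    and AX: "\<And>s. (closed_loop M (riccati_gain M X) *v s) \<bullet> (closed_loop M (riccati_gain M X) *v s)
              \<le> \<kappa> * (s \<bullet> s)"
    and \<kappa>: "0 \<le> \<kappa>" "lqr_gamma M * \<kappa> < 1"
    and \<epsilon>: "0 \<le> \<epsilon>" "\<And>s. \<bar>quad_form (riccati_op M X - X) s
        + (lqr_gamma M * (trace (lqr_Sigma M ** X) + c) - c)\<bar> \<le> \<epsilon> * quad_weight l s"
  shows "\<bar>(quad_form P s + q) - (quad_form X s + c)\<bar>
           \<le> \<epsilon> / (1 - lqr_gamma M * \<kappa>) * quad_weight l s"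
proof -
  define \<gamma> \<beta> where "\<gamma> = lqr_gamma M" and "\<beta> = lqr_gamma M * \<kappa>"
  have \<gamma>: "0 < \<gamma>" using M by (simp add: lqr_model_def \<gamma>_def)
  have \<beta>: "0 \<le> \<beta>" "\<beta> < 1" using \<kappa> \<gamma> by (auto simp: \<beta>_def \<gamma>_def)
  \<comment> \<open>The fixed point of the self-improving bound.\<close>
  define b where "b = \<epsilon> / (1 - \<beta>)"
  have b: "\<epsilon> + \<beta> * b = b" "0 \<le> b" using \<beta> \<epsilon> by (auto simp: b_def field_simps)
  define f where "f s = quad_form (P - X) s + (q - c)" for s
  define E where "E K s = quad_form (P - X) (closed_loop M K *v s)
      + trace (lqr_Sigma M ** (P - X)) + (q - c)" for K s
  define D where "D s = quad_form (riccati_op M X - X) s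
      + (\<gamma> * (trace (lqr_Sigma M ** X) + c) - c)" for s
  have sym: "transpose (P - X) = P - X" using P X by (simp add: transpose_diff psd_mat_def)
  have tr: "trace (lqr_Sigma M ** P) = trace (lqr_Sigma M ** (P - X)) + trace (lqr_Sigma M ** X)"
    using trace_mult_add[of "lqr_Sigma M" "P - X" X] by simp
  have ricP: "quad_form (riccati_op M P) s = quad_form P s" for s
    using P(2) by simp
  have diff: "lookahead_cost M P s (- (K *v s)) - lookahead_cost M X s (- (K *v s))
      = \<gamma> * quad_form (P - X) (closed_loop M K *v s)" for K s
    by (simp add: lookahead_cost_def closed_loop_mult quad_form_diff \<gamma>_def algebra_simps
        del: add_uminus_conv_diff)
  have const: "q - c = \<gamma> * (trace (lqr_Sigma M ** (P - X)) + (q - c))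
      + (\<gamma> * (trace (lqr_Sigma M ** X) + c) - c)"
    using q tr by (simp add: \<gamma>_def algebra_simps)
  have upper: "f s \<le> \<gamma> * E (riccati_gain M X) s + D s" for s
  proof -
    have "quad_form P s \<le> lookahead_cost M P s (- (riccati_gain M X *v s))"
      unfolding ricP[symmetric] by (rule riccati_op_le_lookahead_cost[OF M P(1)])
    then have "quad_form P s - quad_form (riccati_op M X) s
        \<le> \<gamma> * quad_form (P - X) (closed_loop M (riccati_gain M X) *v s)"
      unfolding diff[symmetric] lookahead_cost_riccati_gain[OF M X] by simp
    then show ?thesis
      unfolding f_def E_def D_def using const
      by (simp add: quad_form_diff distrib_left) 
  qed
  have lower: "\<gamma> * E (riccati_gain M P) s + D s \<le> f s" for s
  proof -
    have "quad_form (riccati_op M X) s \<le> lookahead_cost M X s (- (riccati_gain M P *v s))"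
      by (rule riccati_op_le_lookahead_cost[OF M X])
    then have "\<gamma> * quad_form (P - X) (closed_loop M (riccati_gain M P) *v s)
        \<le> quad_form P s - quad_form (riccati_op M X) s"
      unfolding diff[symmetric] lookahead_cost_riccati_gain[OF M P(1)] ricP by simp
    then show ?thesis
      unfolding f_def E_def D_def using const
      by (simp add: quad_form_diff distrib_left) 
  qed
  obtain N where N: "0 \<le> N" "\<And>s. \<bar>f s\<bar> \<le> N * quad_weight l s"
    unfolding f_def using quadratic_has_weight_bound[OF l] by metis
  have err: "\<bar>f s\<bar> \<le> (b + \<beta> ^ n * N) * quad_weight l s" for n s
  proof (induction n arbitrary: s)
    case 0
    have "N * quad_weight l s \<le> (b + \<beta> ^ 0 * N) * quad_weight l s"
      using b quad_weight_ge_1[OF l, of s] by (intro mult_right_mono) auto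
    then show ?case using N(2)[of s] by simp
  next
    case (Suc n)
    have e: "0 \<le> b + \<beta> ^ n * N" using b \<beta> N(1) by simp
    have E: "\<bar>\<gamma> * E K s\<bar> \<le> \<beta> * (b + \<beta> ^ n * N) * quad_weight l s"
      if "\<And>s. (closed_loop M K *v s) \<bullet> (closed_loop M K *v s) \<le> \<kappa> * (s \<bullet> s)" for K
    proof -
      have "\<bar>E K s\<bar> \<le> (b + \<beta> ^ n * N) * (\<kappa> * quad_weight l s)"
        unfolding E_def
        by (rule expected_quad_form_contraction[OF M sym l S that e Suc[unfolded f_def]])
      then have "\<gamma> * \<bar>E K s\<bar> \<le> \<gamma> * ((b + \<beta> ^ n * N) * (\<kappa> * quad_weight l s))"
        using \<gamma> by (intro mult_left_mono) auto
      then show ?thesis using \<gamma> by (simp add: abs_mult \<beta>_def \<gamma>_def mult_ac)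
    qed
    have "\<bar>D s\<bar> \<le> \<epsilon> * quad_weight l s" unfolding D_def \<gamma>_def by (rule \<epsilon>(2))
    then have "\<bar>f s\<bar> \<le> \<beta> * (b + \<beta> ^ n * N) * quad_weight l s + \<epsilon> * quad_weight l s"
      using upper[of s] lower[of s] E[OF AX] E[OF AP] by linarith
    also have "\<dots> = ((\<epsilon> + \<beta> * b) + \<beta> ^ Suc n * N) * quad_weight l s"
      by (simp add: algebra_simps)
    finally show ?case unfolding b(1) .
  qed
  have "(\<lambda>n. (b + \<beta> ^ n * N) * quad_weight l s) \<longlonglongrightarrow> (b + 0 * N) * quad_weight l s"
    using \<beta> by (intro tendsto_intros LIMSEQ_realpow_zero) auto
  then have "\<bar>f s\<bar> \<le> (b + 0 * N) * quad_weight l s"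
    by (rule LIMSEQ_le_const) (use err in blast)
  then show ?thesis
    by (simp add: f_def quad_form_diff b_def \<beta>_def algebra_simps)
qed

lemma max_singular_value_bound:
  fixes X :: "real^'n^'m"
  assumes "(max_singular_value X)\<^sup>2 \<le> \<kappa>"
  shows "(X *v x) \<bullet> (X *v x) \<le> \<kappa> * (x \<bullet> x)"
  using norm_mult_le_max_singular_value[of X x] mult_right_mono[OF assms, of "x \<bullet> x"] by simp

lemma mat_spectral_radius_symmetric_nonneg:
  fixes D :: "real^'n^'n"
  assumes "transpose D = D"
  shows "0 \<le> mat_spectral_radius D"
proof -
  obtain i :: 'n where True by simp
  have "axis i (1::real) \<bullet> axis i 1 = 1" by (simp add: inner_axis)
  then show ?thesis
    using abs_quad_form_le_mat_spectral_radius[OF assms, of "axis i 1"] by simp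
qed

theorem proposition1:
  fixes M Mh :: "('s::finite, 'a::finite) lqr" and l \<gamma> \<kappa> :: real
  assumes "lqr_model M" and "lqr_model Mh"
    and "lqr_gamma M = \<gamma>" and "lqr_gamma Mh = \<gamma>"
    and "lqr_stab_det M" and "lqr_stab_det Mh"
    and "l > 0"
    and "dp_solvable M (quad_weight l)" and "dp_solvable Mh (quad_weight l)"
    and "b_Sigma l M Mh < 1 / \<gamma>" and "b_sigma M Mh < 1 / \<gamma>"
    and "\<kappa> = max (b_Sigma l M Mh) (b_sigma M Mh)"
  shows "(\<forall>\<alpha>\<^sub>2 :: real.
            wnorm (quad_weight l)
              (\<lambda>s. enn2ereal (policy_value M (linear_policy (opt_gain Mh)) s)
                   - enn2ereal (optimal_value M s))
            \<le> ereal (1 / (1 - \<gamma> * \<kappa>) *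
                (max (mat_spectral_radius (D_star M Mh) / l) \<bar>d_Sigma M Mh + \<alpha>\<^sub>2\<bar>
                 + max (mat_spectral_radius (D_policy M Mh) / l) \<bar>d_Sigma M Mh + \<alpha>\<^sub>2\<bar>)))
       \<and> wnorm (quad_weight l)
           (\<lambda>s. enn2ereal (policy_value M (linear_policy (opt_gain Mh)) s)
                - enn2ereal (optimal_value M s))
         \<le> ereal (1 / (l * (1 - \<gamma> * \<kappa>)) *
             (mat_spectral_radius (D_star M Mh) + mat_spectral_radius (D_policy M Mh)))"
proof -
  note M = assms(1) and Mh = assms(2) and l = assms(7)
  have \<gamma>: "lqr_gamma M = \<gamma>" "lqr_gamma Mh = \<gamma>" "0 < \<gamma>" "\<gamma> < 1"
    using assms by (auto simp: lqr_model_def)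
  have \<gamma>\<kappa>: "\<gamma> * \<kappa> < 1"
    using assms(10-12) \<gamma>(3) by (simp add: max_def field_simps split: if_splits)
  have S: "1 + l * trace (lqr_Sigma M) \<le> \<kappa>" "1 + l * trace (lqr_Sigma Mh) \<le> \<kappa>"
    unfolding assms(12) b_Sigma_def by auto
  have sig: "(max_singular_value (closed_loop M (opt_gain M)))\<^sup>2 \<le> \<kappa>"
    "(max_singular_value (closed_loop M (opt_gain Mh)))\<^sup>2 \<le> \<kappa>"
    "(max_singular_value (closed_loop Mh (opt_gain Mh)))\<^sup>2 \<le> \<kappa>"
    "(max_singular_value (closed_loop M (greedy_gain M Mh)))\<^sup>2 \<le> \<kappa>"
    unfolding assms(12) b_sigma_def by (auto intro!: max.coboundedI2 Max_ge)
  have \<kappa>: "0 \<le> \<kappa>" using sig(1) by (rule order.trans[OF zero_le_power2])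
  note \<kappa>M = \<kappa> \<gamma>\<kappa>[folded \<gamma>(1)] and \<kappa>Mh = \<kappa> \<gamma>\<kappa>[folded \<gamma>(2)]
  define P q Ph qh where "P = riccati_sol M" and "q = optimal_offset M"
    and "Ph = riccati_sol Mh" and "qh = optimal_offset Mh"
  note V = optimal_value_quadratic[OF M assms(5) l assms(8) S(1) max_singular_value_bound[OF sig(1)] \<kappa>M,
      folded P_def q_def]
  note Vh = optimal_value_quadratic[OF Mh assms(6) l assms(9) S(2) max_singular_value_bound[OF sig(3)] \<kappa>Mh,
      folded Ph_def qh_def]
  have greedy: "greedy_gain M Mh = riccati_gain M Ph"
    by (rule greedy_gain_eqI[OF M Vh(1,3,5)])
  have gain: "opt_gain M = riccati_gain M P"
    by (simp add: opt_gain_riccati_gain P_def)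
  have symPh: "transpose Ph = Ph" using Vh(1) by (simp add: psd_mat_def)
  have Ds: "D_star M Mh = riccati_op M Ph - Ph"
    by (simp add: D_star_def Ph_def)
  have Dp: "D_policy M Mh = evaluation_op M (opt_gain Mh) Ph - Ph"
    by (simp add: D_policy_def evaluation_op_def Let_def Ph_def)
  have symDs: "transpose (D_star M Mh) = D_star M Mh"
    using riccati_op_psd[OF M Vh(1)] symPh by (simp add: Ds transpose_diff psd_mat_def)
  have symDp: "transpose (D_policy M Mh) = D_policy M Mh"
    using transpose_evaluation_op[OF M symPh] symPh by (simp add: Dp transpose_diff)
  let ?\<rho>s = "mat_spectral_radius (D_star M Mh)" and ?\<rho>p = "mat_spectral_radius (D_policy M Mh)"
  have bound: "wnorm (quad_weight l)
      (\<lambda>s. enn2ereal (policy_value M (linear_policy (opt_gain Mh)) s) - enn2ereal (optimal_value M s))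
    \<le> ereal (1 / (1 - \<gamma> * \<kappa>) * (max (?\<rho>s / l) \<bar>d_Sigma M Mh + \<alpha>\<bar> + max (?\<rho>p / l) \<bar>d_Sigma M Mh + \<alpha>\<bar>))"
    for \<alpha>
    unfolding wnorm_def
  proof (rule SUP_least)
    fix s
    \<comment> \<open>This shift turns the constant part of both Bellman residuals into \<open>d_Sigma M Mh + \<alpha>\<close>.\<close>
    define c where "c = qh - \<alpha> / (1 - \<gamma>)"
    define d where "d = d_Sigma M Mh + \<alpha>"
    have offset: "(1 - \<gamma>) * qh = \<gamma> * trace (lqr_Sigma Mh ** Ph)"
      using Vh(4) by (simp add: \<gamma> algebra_simps)
    have tr: "trace ((lqr_Sigma M - lqr_Sigma Mh) ** Ph)
        = trace (lqr_Sigma M ** Ph) - trace (lqr_Sigma Mh ** Ph)"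
      by (simp add: trace_def matrix_matrix_mult_def left_diff_distrib sum_subtractf)
    have "(1 - \<gamma>) * c = (1 - \<gamma>) * qh - \<alpha>"
      using \<gamma>(4) by (simp add: c_def right_diff_distrib)
    then have d: "lqr_gamma M * (trace (lqr_Sigma M ** Ph) + c) - c = d"
      using offset unfolding d_def d_Sigma_def \<gamma>(1) Ph_def[symmetric] tr
      by (simp add: algebra_simps)
    define \<epsilon>s \<epsilon>p where "\<epsilon>s = max (?\<rho>s / l) \<bar>d\<bar>" and "\<epsilon>p = max (?\<rho>p / l) \<bar>d\<bar>"
    have \<epsilon>0: "0 \<le> \<epsilon>s" "0 \<le> \<epsilon>p" by (auto simp: \<epsilon>s_def \<epsilon>p_def)
    have \<epsilon>s: "\<bar>quad_form (riccati_op M Ph - Ph) s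
        + (lqr_gamma M * (trace (lqr_Sigma M ** Ph) + c) - c)\<bar> \<le> \<epsilon>s * quad_weight l s" for s
      unfolding d \<epsilon>s_def Ds[symmetric] by (rule abs_quadratic_le_weight[OF symDs l])
    have \<epsilon>p: "\<bar>quad_form (evaluation_op M (opt_gain Mh) Ph - Ph) s
        + (lqr_gamma M * (trace (lqr_Sigma M ** Ph) + c) - c)\<bar> \<le> \<epsilon>p * quad_weight l s" for s
      unfolding d \<epsilon>p_def Dp[symmetric] by (rule abs_quadratic_le_weight[OF symDp l])
    obtain v where v: "0 \<le> v" "policy_value M (linear_policy (opt_gain Mh)) s = ennreal v"
      and ev: "\<bar>v - (quad_form Ph s + c)\<bar> \<le> \<epsilon>p / (1 - lqr_gamma M * \<kappa>) * quad_weight l s"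
      using policy_value_error[OF M l symPh S(1) max_singular_value_bound[OF sig(2)] \<kappa>M \<epsilon>0(2) \<epsilon>p]
      by metis
    have es: "\<bar>(quad_form P s + q) - (quad_form Ph s + c)\<bar>
        \<le> \<epsilon>s / (1 - lqr_gamma M * \<kappa>) * quad_weight l s"
      by (rule optimal_value_error[OF M l V(1,2,4) Vh(1) S(1)
          max_singular_value_bound[OF sig(1)[unfolded gain]]
          max_singular_value_bound[OF sig(4)[unfolded greedy]] \<kappa>M \<epsilon>0(1) \<epsilon>s])
    have w: "0 < quad_weight l s" using quad_weight_ge_1[OF l, of s] by simp
    have nn: "0 \<le> quad_form P s + q" using V(1,3) by (simp add: psd_mat_alt)
    have "\<bar>v - (quad_form P s + q)\<bar>
        \<le> \<epsilon>s / (1 - \<gamma> * \<kappa>) * quad_weight l s + \<epsilon>p / (1 - \<gamma> * \<kappa>) * quad_weight l s"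
      using ev es unfolding \<gamma>(1) by linarith
    also have "\<dots> = 1 / (1 - \<gamma> * \<kappa>) * (\<epsilon>s + \<epsilon>p) * quad_weight l s"
      by (simp add: add_divide_distrib algebra_simps)
    finally have "\<bar>v - (quad_form P s + q)\<bar> / quad_weight l s \<le> 1 / (1 - \<gamma> * \<kappa>) * (\<epsilon>s + \<epsilon>p)"
      using w by (simp add: pos_divide_le_eq)
    moreover have "\<bar>enn2ereal (policy_value M (linear_policy (opt_gain Mh)) s)
          - enn2ereal (optimal_value M s)\<bar> / ereal (quad_weight l s)
        = ereal (\<bar>v - (quad_form P s + q)\<bar> / quad_weight l s)"
      using w by (simp add: v V(5) enn2ereal_ennreal[OF v(1)] enn2ereal_ennreal[OF nn]
          del: ennreal_plus)
    ultimately show "\<bar>enn2ereal (policy_value M (linear_policy (opt_gain Mh)) s)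
          - enn2ereal (optimal_value M s)\<bar> / ereal (quad_weight l s)
        \<le> ereal (1 / (1 - \<gamma> * \<kappa>) * (max (?\<rho>s / l) \<bar>d_Sigma M Mh + \<alpha>\<bar> + max (?\<rho>p / l) \<bar>d_Sigma M Mh + \<alpha>\<bar>))"
      by (simp add: \<epsilon>s_def \<epsilon>p_def d_def)
  qed
  have "0 \<le> ?\<rho>s / l" "0 \<le> ?\<rho>p / l"
    using mat_spectral_radius_symmetric_nonneg[OF symDs]
      mat_spectral_radius_symmetric_nonneg[OF symDp] l by auto
  then have calibrated: "1 / (1 - \<gamma> * \<kappa>) * (max (?\<rho>s / l) \<bar>d_Sigma M Mh + - d_Sigma M Mh\<bar>
        + max (?\<rho>p / l) \<bar>d_Sigma M Mh + - d_Sigma M Mh\<bar>)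
      = 1 / (l * (1 - \<gamma> * \<kappa>)) * (?\<rho>s + ?\<rho>p)"
    by (simp add: max_absorb1 add_divide_distrib[symmetric])
  show ?thesis
    using bound bound[of "- d_Sigma M Mh", unfolded calibrated] by (intro conjI allI)
qed

end
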